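(* Let $p$ be an odd prime, $q$ a power of $p$, $j$ a positive integer, and define $n$ by $2n=p^j+1$. Let $G=\mathrm{Sp}_{2n}(q)$ and $H=\mathrm{PSp}_{2n}(q)$. Let $$g_j=\begin{pmatrix} I_n & (-1)^{j(p-1)/2}E_{n,n}\\ 0& I_n\end{pmatrix}\in G,$$ and let $[g_j]\in H$ be the image of $g_j$ under the quotient map $G\to H$. Suppose that $p\equiv 1\bmod 4$ and that $q$ is an odd power of $p$ (that is, $q=p^k$ with $k$ odd). Then $G$ is non-$FSZ_{p^j}$ at $g_j$, and $H$ is non-$FSZ_{p^j}$ at $[g_j]$.
   Context: $\mathrm{Sp}_{2n}(q)$ is the group of $2n\times 2n$ matrices over the finite field $\mathbb{F}_q$, written in $n\times n$ blocks as $\begin{pmatrix} X&A\\ B&Y\end{pmatrix}$, satisfying $$\begin{pmatrix} X&A\\ B&Y\end{pmatrix}\begin{pmatrix} Y^T&-A^T\\ -B^T&X^T\end{pmatrix}=I_{2n}.$$ Its center is generated by $-I_{2n}$, and $\mathrm{PSp}_{2n}(q)=\mathrm{Sp}_{2n}(q)/Z(\mathrm{Sp}_{2n}(q))$. $E_{n,n}$ denotes the $n\times n$ matrix with a $1$ in position $(n,n)$ and zeros elsewhere. For a finite group $G$, a positive integer $m$, and $u,g\in G$, define $G_m(u,g)=\{a\in G : a^m=(au)^m=g\}$. The group $G$ is non-$FSZ_m$ at $g\in G$ if for some $u\in G$ and some positive integer $k$ coprime to $|G|$ we have $|G_m(u,g)|\neq|G_m(u,g^k)|$. *)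

theory Defs
  imports "Jordan_Normal_Form.Determinant" "HOL-Algebra.Coset"
    "HOL-Library.Cardinality" "HOL-Computational_Algebra.Primes"
begin

definition FSZ_set :: "('g, 'm) monoid_scheme \<Rightarrow> nat \<Rightarrow> 'g \<Rightarrow> 'g \<Rightarrow> 'g set" where
  "FSZ_set G m u g =
     {a \<in> carrier G. a [^]\<^bsub>G\<^esub> m = g \<and> (a \<otimes>\<^bsub>G\<^esub> u) [^]\<^bsub>G\<^esub> m = g}"

definition non_FSZ_at :: "('g, 'm) monoid_scheme \<Rightarrow> nat \<Rightarrow> 'g \<Rightarrow> bool" where
  "non_FSZ_at G m g \<longleftrightarrow>
     g \<in> carrier G \<and>
     (\<exists>u \<in> carrier G. \<exists>k::nat. k > 0 \<and> coprime k (card (carrier G)) \<and>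
        card (FSZ_set G m u g) \<noteq> card (FSZ_set G m u (g [^]\<^bsub>G\<^esub> k)))"

definition center :: "('g, 'm) monoid_scheme \<Rightarrow> 'g set" where
  "center G = {z \<in> carrier G. \<forall>x \<in> carrier G. z \<otimes>\<^bsub>G\<^esub> x = x \<otimes>\<^bsub>G\<^esub> z}"

definition Sp :: "'a::field itself \<Rightarrow> nat \<Rightarrow> 'a mat monoid" where
  "Sp F n =
     \<lparr>carrier = {four_block_mat X A B Y | X A B Y.
         X \<in> carrier_mat n n \<and> A \<in> carrier_mat n n \<and>
         B \<in> carrier_mat n n \<and> Y \<in> carrier_mat n n \<and>
         four_block_mat X A B Y *
           four_block_mat (transpose_mat Y) (- transpose_mat A)
                          (- transpose_mat B) (transpose_mat X) = 1\<^sub>m (2 * n)},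
      mult = (*), one = 1\<^sub>m (2 * n)\<rparr>"

definition PSp :: "'a::field itself \<Rightarrow> nat \<Rightarrow> 'a mat set monoid" where
  "PSp F n = Sp F n Mod center (Sp F n)"

definition PSp_proj :: "nat \<Rightarrow> 'a::field mat \<Rightarrow> 'a mat set" where
  "PSp_proj n M = center (Sp TYPE('a) n) #>\<^bsub>Sp TYPE('a) n\<^esub> M"

text \<open>Rows and columns of matrices are numbered from \<open>0\<close>, so position
  \<open>(n, n)\<close> in the usual numbering is \<open>(n - 1, n - 1)\<close> here.\<close>

definition E_last :: "nat \<Rightarrow> 'a::field mat" where
  "E_last n = mat n n (\<lambda>(r, c). if r = n - 1 \<and> c = n - 1 then 1 else 0)"

definition g_mat :: "nat \<Rightarrow> nat \<Rightarrow> nat \<Rightarrow> 'a::field mat" where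
  "g_mat p j n =
     four_block_mat (1\<^sub>m n) ((-1) ^ (j * (p - 1) div 2) \<cdot>\<^sub>m E_last n)
                    (0\<^sub>m n n) (1\<^sub>m n)"

end

theory Submission
  imports Defs "HOL-Library.Function_Algebras" "HOL-Number_Theory.Number_Theory"
begin

text \<open>
  Write \<open>m = p\<^sup>j = 2n - 1\<close> and \<open>R\<^sub>k = {a. a\<^sup>m = g\<^sup>k}\<close>. For \<open>\<chi>\<close> the quadratic character of the field,
  \<open>l\<close> the vector spanning the image of \<open>g - 1\<close>, and \<open>D\<close> the vectors orthogonal to \<open>l\<close> and not
  proportional to it, put \<open>\<phi>(u) = \<Sum>v\<in>D. \<chi>(\<omega>(v, u v))\<close>. Then
  \<open>\<Sum>u. \<phi>(u) |G\<^sub>m(u, g\<^sup>k)| = \<Sum>a,b\<in>R\<^sub>k. \<Sum>v\<in>D. \<chi>(\<omega>(a v, b v))\<close>, and it suffices that this number has the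
  sign \<open>\<chi>(k)\<close>: choosing \<open>k\<close> a nonsquare, which is possible because the field has odd degree over its
  prime field, some \<open>|G\<^sub>m(u, g)|\<close> differs from \<open>|G\<^sub>m(u, g\<^sup>k)|\<close>.

  Averaging over conjugation by the transvections that centralise \<open>g\<close> reduces the double sum to a
  positive multiple of \<open>\<Sum>b\<in>R\<^sub>k. \<Sum>v\<in>D. \<chi>(\<omega>(v, b v))\<close>. As \<open>(b - 1)\<^sup>m = g\<^sup>k - 1 \<noteq> 0\<close> in dimension \<open>m + 1\<close>,
  \<open>N = b - 1\<close> is a single nilpotent Jordan block, so \<open>v \<mapsto> \<omega>(v, b v)\<close> is a quadratic form whose radical
  is a line. Its rank is odd, it is hyperbolic up to the summand \<open>\<plusminus>k t\<^sup>2\<close> seen on \<open>ker N\<^sup>n\<^sup>+\<^sup>1 / ker N\<^sup>n\<close>, and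
  \<open>-1\<close> is a square, whence the sign.

  Since \<open>\<phi>(-u) = \<phi>(u)\<close>, the same sums distinguish \<open>|G\<^sub>m(u, g)| + |G\<^sub>m(-u, g)|\<close> from its analogue for
  \<open>g\<^sup>k\<close>, and, \<open>m\<close> being odd, this is the corresponding number for the projective group.
\<close>

subsection \<open>Quadratic characters and symplectic spaces\<close>

text \<open>\<open>chi_minus_1\<close> encodes that the order of the field is 1 modulo 4. It makes
  \<open>\<chi> (\<omega> x y)\<close> symmetric although \<omega> is alternating.\<close>

locale quadratic_char =
  fixes \<chi> :: "'a::{field,finite} \<Rightarrow> int"
  assumes chi_mult: "\<chi> (x * y) = \<chi> x * \<chi> y"
    and chi_0 [simp]: "\<chi> 0 = 0"
    and chi_square: "x \<noteq> 0 \<Longrightarrow> \<chi> x * \<chi> x = 1"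
    and chi_minus_1: "\<chi> (- 1) = 1"
    and chi_nonsquare: "\<exists>d. \<chi> d = - 1"
begin

lemma chi_1 [simp]: "\<chi> 1 = 1"
  using chi_mult[of "-1" "-1"] chi_minus_1 by simp

lemma chi_minus [simp]: "\<chi> (- x) = \<chi> x"
  using chi_mult[of "-1" x] chi_minus_1 by simp

lemma chi_sign [simp]: "\<chi> ((- 1) ^ i * x) = \<chi> x"
  by (cases "even i") auto

text \<open>Multiplication by a nonsquare permutes the field and reverses the sign of every
  term.\<close>

lemma sum_chi: "(\<Sum>x\<in>UNIV. \<chi> x) = 0"
proof -
  obtain d where d: "\<chi> d = - 1" using chi_nonsquare by blast
  then have d0: "d \<noteq> 0" by auto
  have "(\<Sum>x\<in>UNIV. \<chi> x) = (\<Sum>x\<in>UNIV. \<chi> (d * x))"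
    by (rule sum.reindex_bij_witness[of _ "\<lambda>x. d * x" "\<lambda>x. x / d"]) (use d0 in auto)
  then show ?thesis using d by (simp add: chi_mult sum_negf)
qed

lemma sum_chi_translate: "(\<Sum>t\<in>UNIV. \<chi> (x + t)) = 0"
proof -
  have "(\<Sum>t\<in>UNIV. \<chi> (x + t)) = (\<Sum>x\<in>UNIV. \<chi> x)"
    by (rule sum.reindex_bij_witness[of _ "\<lambda>t. t - x" "\<lambda>t. x + t"]) auto
  then show ?thesis by (simp add: sum_chi)
qed

text \<open>Every translate \<open>f y + t\<close> is reached by permuting \<open>K\<close>, so
  averaging over \<open>t\<close> turns each term into a complete character sum.\<close>

lemma sum_chi_equidistributed:
  assumes "\<And>t. bij_betw (\<pi> t) K K" and "\<And>t y. y \<in> K \<Longrightarrow> f (\<pi> t y) = f y + t"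
  shows "(\<Sum>y\<in>K. \<chi> (f y)) = 0"
proof -
  have "of_nat (CARD('a)) * (\<Sum>y\<in>K. \<chi> (f y)) = (\<Sum>t\<in>(UNIV::'a set). \<Sum>y\<in>K. \<chi> (f y))"
    by simp
  also have "\<dots> = (\<Sum>t\<in>(UNIV::'a set). \<Sum>y\<in>K. \<chi> (f (\<pi> t y)))"
    by (intro sum.cong refl sum.reindex_bij_betw[symmetric] assms)
  also have "\<dots> = (\<Sum>t\<in>(UNIV::'a set). \<Sum>y\<in>K. \<chi> (f y + t))"
    by (intro sum.cong refl) (simp add: assms)
  also have "\<dots> = (\<Sum>y\<in>K. \<Sum>t\<in>(UNIV::'a set). \<chi> (f y + t))"
    by (rule sum.swap)
  finally show ?thesis by (simp add: sum_chi_translate)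
qed

end

section \<open>Symplectic spaces with a distinguished vector\<close>

locale symp_space = vector_space scale
  for scale :: "'a::{field,finite} \<Rightarrow> 'v::ab_group_add \<Rightarrow> 'v" (infixr "*s" 75) +
  fixes U :: "'v set" and \<omega> :: "'v \<Rightarrow> 'v \<Rightarrow> 'a" and l :: 'v and n :: nat
  assumes U_sub: "subspace U" and U_fin: "finite U" and U_card: "card U = CARD('a) ^ (2 * n)"
    and n_ge: "n \<ge> 2"
    and form_add [simp]: "\<omega> (x + y) z = \<omega> x z + \<omega> y z"
    and form_scale [simp]: "\<omega> (c *s x) z = c * \<omega> x z"
    and form_anti: "\<omega> x y = - \<omega> y x"
    and form_self [simp]: "\<omega> x x = 0"
    and nondeg: "x \<in> U \<Longrightarrow> (\<And>y. y \<in> U \<Longrightarrow> \<omega> x y = 0) \<Longrightarrow> x = 0"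
    and l_U: "l \<in> U" and l_nz: "l \<noteq> 0"
    and two_nz: "(2::'a) \<noteq> 0"
begin

lemmas U_closed = subspace_add[OF U_sub] subspace_scale[OF U_sub] subspace_diff[OF U_sub]
  subspace_neg[OF U_sub] subspace_0[OF U_sub] l_U

lemma form_add_right [simp]: "\<omega> z (x + y) = \<omega> z x + \<omega> z y"
  using form_anti[of z "x + y"] form_anti[of z x] form_anti[of z y] by simp

lemma form_scale_right [simp]: "\<omega> z (c *s x) = c * \<omega> z x"
  using form_anti[of z "c *s x"] form_anti[of z x] by simp

lemma form_0 [simp]: "\<omega> 0 z = 0" "\<omega> z 0 = 0"
  using form_scale[of 0 0 z] form_scale_right[of z 0 0] by simp_all

lemma form_minus [simp]: "\<omega> (- x) z = - \<omega> x z" "\<omega> z (- x) = - \<omega> z x"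
  using form_scale[of "-1" x z] form_scale_right[of z "-1" x] by simp_all

lemma form_diff [simp]: "\<omega> (x - y) z = \<omega> x z - \<omega> y z" "\<omega> z (x - y) = \<omega> z x - \<omega> z y"
  using form_add[of x "-y" z] form_add_right[of z x "-y"] by simp_all

text \<open>The hyperplane \<open>L\<close> is the orthogonal complement of \<open>l\<close>, and
  the line \<open>Fl\<close> is the radical of the form on it.\<close>

definition L where "L = {v \<in> U. \<omega> v l = 0}"
definition Fl where "Fl = range (\<lambda>c. c *s l)"

lemma L_closed:
  "x \<in> L \<Longrightarrow> y \<in> L \<Longrightarrow> x + y \<in> L" "x \<in> L \<Longrightarrow> y \<in> L \<Longrightarrow> x - y \<in> L"
  "x \<in> L \<Longrightarrow> c *s x \<in> L" "l \<in> L"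
  unfolding L_def by (auto intro: U_closed)

lemma L_U: "x \<in> L \<Longrightarrow> x \<in> U" and L_l: "x \<in> L \<Longrightarrow> \<omega> x l = 0"
  and l_L: "x \<in> L \<Longrightarrow> \<omega> l x = 0"
  using form_anti[of l x] unfolding L_def by auto

lemma FlI [simp]: "c *s l \<in> Fl"
  unfolding Fl_def by blast

lemma finite_L: "finite L"
  using U_fin unfolding L_def by simp

lemma dual:
  assumes "x \<in> U" "x \<noteq> 0" obtains y where "y \<in> U" "\<omega> x y = c"
proof -
  obtain y where y: "y \<in> U" "\<omega> x y \<noteq> 0" using nondeg assms by blast
  show ?thesis
    by (rule that[of "(c / \<omega> x y) *s y"]) (use y in \<open>auto intro: U_closed\<close>)
qed

lemma ex_dual_l: obtains x where "x \<in> U" "\<omega> x l = 1"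
proof -
  obtain y where "y \<in> U" "\<omega> l y = - 1" using dual[OF l_U l_nz, of "-1"] .
  then show ?thesis using that form_anti[of y l] by auto
qed

text \<open>\<open>U\<close> is spanned by \<open>L\<close> and a vector \<open>x\<close> dual to
  \<open>l\<close>. Adding a multiple of \<open>l\<close> to \<open>w\<close> kills the pairing with
  \<open>x\<close> and keeps those with \<open>L\<close>, so nondegeneracy applies.\<close>

lemma perp_L:
  assumes w: "w \<in> U" and perp: "\<And>y. y \<in> L \<Longrightarrow> \<omega> w y = 0"
  shows "w \<in> Fl"
proof -
  obtain x where x: "x \<in> U" "\<omega> x l = 1" using ex_dual_l .
  have "w + \<omega> w x *s l = 0"
  proof (rule nondeg)
    show "w + \<omega> w x *s l \<in> U" using w by (auto intro: U_closed)
    fix y assume y: "y \<in> U"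
    have "y - \<omega> y l *s x \<in> L" using x y unfolding L_def by (auto intro: U_closed)
    from perp[OF this] show "\<omega> (w + \<omega> w x *s l) y = 0"
      by (simp add: form_anti[of l y] algebra_simps)
  qed
  then have "w = (- \<omega> w x) *s l"
    by (simp add: add_eq_0_iff2)
  then show ?thesis unfolding Fl_def by blast
qed

lemma ex_dual_in_L:
  assumes v: "v \<in> L" "v \<notin> Fl" obtains y where "y \<in> L" "\<omega> v y = 1"
proof -
  obtain y where y: "y \<in> L" "\<omega> v y \<noteq> 0" using perp_L v L_U by blast
  show ?thesis
    by (rule that[of "(1 / \<omega> v y) *s y"]) (use y in \<open>auto intro: L_closed\<close>)
qed

definition K where "K v = {y \<in> L. \<omega> v y = 0}"

lemma K_closed:
  "x \<in> K v \<Longrightarrow> y \<in> K v \<Longrightarrow> x + y \<in> K v" "x \<in> K v \<Longrightarrow> y \<in> K v \<Longrightarrow> x - y \<in> K v"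
  "x \<in> K v \<Longrightarrow> c *s x \<in> K v"
  unfolding K_def by (auto intro: L_closed)

lemma K_L: "x \<in> K v \<Longrightarrow> x \<in> L" and K_form: "x \<in> K v \<Longrightarrow> \<omega> v x = 0"
  unfolding K_def by auto

lemma perp_K:
  assumes v: "v \<in> L" "v \<notin> Fl" and w: "w \<in> U" and perp: "\<And>y. y \<in> K v \<Longrightarrow> \<omega> w y = 0"
  obtains \<alpha> \<beta> where "w = \<alpha> *s v + \<beta> *s l"
proof -
  obtain x where x: "x \<in> L" "\<omega> v x = 1" using ex_dual_in_L[OF v] .
  have "w - \<omega> w x *s v \<in> Fl"
  proof (rule perp_L)
    show "w - \<omega> w x *s v \<in> U" using w v by (auto intro: U_closed L_U)
    fix y assume y: "y \<in> L"
    have "y - \<omega> v y *s x \<in> K v" using x y unfolding K_def by (auto intro: L_closed)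
    from perp[OF this] show "\<omega> (w - \<omega> w x *s v) y = 0"
      by (simp add: algebra_simps)
  qed
  then obtain \<beta> where "w - \<omega> w x *s v = \<beta> *s l" unfolding Fl_def by blast
  then have "w = \<omega> w x *s v + \<beta> *s l" by (simp add: algebra_simps)
  then show ?thesis using that by blast
qed

section \<open>Symplectic transvections\<close>

definition transv where "transv x c v = v + (c * \<omega> v x) *s x"

lemma transv_U: "x \<in> U \<Longrightarrow> v \<in> U \<Longrightarrow> transv x c v \<in> U"
  unfolding transv_def by (intro U_closed)

lemma transv_form: "\<omega> (transv x c v) (transv x c w) = \<omega> v w"
  unfolding transv_def using form_anti[of x w] by (simp add: algebra_simps)

lemma transv_add: "transv x c (v + w) = transv x c v + transv x c w"
  and transv_scale: "transv x c (r *s v) = r *s transv x c v"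
  unfolding transv_def by (simp_all add: algebra_simps)

lemma transv_l: "x \<in> L \<Longrightarrow> transv x c l = l"
  unfolding transv_def using l_L by simp

lemma transv_inverse [simp]: "transv x (- c) (transv x c v) = v" "transv x c (transv x (- c) v) = v"
  unfolding transv_def by (simp_all add: algebra_simps)

text \<open>A transvection along \<open>w - v\<close> carries \<open>v\<close> to \<open>w\<close>
  when the two are not orthogonal. Otherwise a third vector, orthogonal to neither, joins
  them.\<close>

lemma transv_invariant_imp_const:
  assumes inv: "\<And>x c v. x \<in> L \<Longrightarrow> v \<in> L \<Longrightarrow> f (transv x c v) = f v"
    and v: "v \<in> L" "v \<notin> Fl" and w: "w \<in> L" "w \<notin> Fl"
  shows "f v = f w"
proof -
  have step: "f v = f w" if "v \<in> L" "w \<in> L" "\<omega> v w \<noteq> 0" for v w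
  proof -
    have "transv (w - v) (1 / \<omega> v w) v = w"
      using that unfolding transv_def by simp
    then show ?thesis using inv[of "w - v" v "1 / \<omega> v w"] that L_closed by simp
  qed
  obtain x y where xy: "x \<in> L" "\<omega> v x = 1" "y \<in> L" "\<omega> w y = 1"
    using ex_dual_in_L v w by metis
  have "\<exists>z\<in>L. \<omega> v z \<noteq> 0 \<and> \<omega> w z \<noteq> 0"
  proof (cases "\<omega> w x = 0 \<and> \<omega> v y = 0")
    case True
    then show ?thesis using xy by (intro bexI[of _ "x + y"]) (auto intro: L_closed)
  next
    case False
    then show ?thesis using xy by (metis zero_neq_one)
  qed
  then obtain z where z: "z \<in> L" "\<omega> v z \<noteq> 0" "\<omega> w z \<noteq> 0" by blast
  show ?thesis using step[OF v(1) z(1,2)] step[OF w(1) z(1,3)] by simp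
qed

end

subsection \<open>Roots of a transvection\<close>

text \<open>In characteristic p with \<open>2 * n - 1\<close> a power of p, \<open>b_root\<close>
  says that \<open>b\<close> raised to that power is the transvection
  \<open>transv l \<kappa>\<close> on \<open>U\<close>.\<close>

locale symp_root = symp_space +
  fixes b :: "'b \<Rightarrow> 'b" and \<kappa> :: 'a
  assumes b_add [simp]: "b (x + y) = b x + b y"
    and b_scale [simp]: "b (c *s x) = c *s b x"
    and b_U: "x \<in> U \<Longrightarrow> b x \<in> U"
    and b_form: "x \<in> U \<Longrightarrow> y \<in> U \<Longrightarrow> \<omega> (b x) (b y) = \<omega> x y"
    and \<kappa>_nz: "\<kappa> \<noteq> 0"
    and b_root: "x \<in> U \<Longrightarrow> ((\<lambda>v. b v - v) ^^ (2 * n - 1)) x = (\<kappa> * \<omega> x l) *s l"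
begin

definition N where "N v = b v - v"

lemma N_eq: "(\<lambda>v. b v - v) = N" by (simp add: N_def fun_eq_iff)

lemma N_add: "N (x + y) = N x + N y" and N_scale: "N (c *s x) = c *s N x"
  unfolding N_def by (simp_all add: algebra_simps)

lemma Npow_add [simp]: "(N ^^ i) (x + y) = (N ^^ i) x + (N ^^ i) y"
  and Npow_scale [simp]: "(N ^^ i) (c *s x) = c *s (N ^^ i) x"
  by (induction i) (simp_all add: N_add N_scale)

lemma Npow_0 [simp]: "(N ^^ i) 0 = 0"
  using Npow_scale[of i 0 0] by simp

lemma Npow_diff [simp]: "(N ^^ i) (x - y) = (N ^^ i) x - (N ^^ i) y"
  using Npow_add[of i x "(-1) *s y"] Npow_scale[of i "-1" y] by simp

lemma Npow_Npow: "(N ^^ i) ((N ^^ j) x) = (N ^^ (i + j)) x"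
  by (simp add: funpow_add)

lemma N_Npow: "N ((N ^^ i) x) = (N ^^ Suc i) x" and Npow_N: "(N ^^ i) (N x) = (N ^^ Suc i) x"
  by (simp_all add: funpow_swap1)

lemma N_U: "x \<in> U \<Longrightarrow> N x \<in> U"
  unfolding N_def by (intro U_closed b_U)

lemma Npow_U: "x \<in> U \<Longrightarrow> (N ^^ i) x \<in> U"
  by (induction i) (auto intro: N_U)

lemma bpow_add [simp]: "(b ^^ i) (x + y) = (b ^^ i) x + (b ^^ i) y"
  and bpow_scale [simp]: "(b ^^ i) (c *s x) = c *s (b ^^ i) x"
  by (induction i) simp_all

lemma bpow_U: "x \<in> U \<Longrightarrow> (b ^^ i) x \<in> U"
  by (induction i) (auto intro: b_U)

lemma b_0 [simp]: "b 0 = 0"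
  using b_scale[of 0 0] by simp

lemma b_diff [simp]: "b (x - y) = b x - b y"
  using b_add[of x "(-1) *s y"] b_scale[of "-1" y] by simp

lemma b_N: "b (N x) = N (b x)"
  unfolding N_def by simp

lemma b_Npow: "b ((N ^^ i) x) = (N ^^ i) (b x)"
  by (induction i) (simp_all add: b_N)

lemma bpow_Npow: "(b ^^ j) ((N ^^ i) x) = (N ^^ i) ((b ^^ j) x)"
  by (induction j) (simp_all add: b_Npow)

lemma Npow_top: "x \<in> U \<Longrightarrow> (N ^^ (2 * n - 1)) x = (\<kappa> * \<omega> x l) *s l"
  using b_root by (simp add: N_eq)

text \<open>\<open>N\<close> commutes with its power, whose image is the line of \<open>l\<close>,
  so \<open>l\<close> is an eigenvector. Its eigenvalue satisfies \<open>c ^ (2 * n - 1) = 0\<close>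
  because \<open>\<omega> l l = 0\<close>.\<close>

lemma N_l [simp]: "N l = 0"
proof -
  obtain x where x: "x \<in> U" "\<omega> x l = 1" using ex_dual_l .
  define c where "c = \<omega> (N x) l"
  have "N ((N ^^ (2 * n - 1)) x) = (N ^^ (2 * n - 1)) (N x)"
    by (simp add: funpow_swap1)
  then have "\<kappa> *s N l = (\<kappa> * c) *s l"
    using x by (simp add: Npow_top N_U N_scale c_def del: One_nat_def)
  then have Nl: "N l = c *s l"
    using \<kappa>_nz by (metis scale_left_imp_eq scale_scale)
  have "(N ^^ i) l = c ^ i *s l" for i
    by (induction i) (simp_all add: N_scale Nl mult_ac)
  then have "c ^ (2 * n - 1) *s l = 0"
    using Npow_top[OF l_U] by (metis form_self mult_zero_right scale_zero_left)
  then have "c = 0" using l_nz by simp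
  then show ?thesis using Nl by simp
qed

lemma b_l [simp]: "b l = l"
  using N_l unfolding N_def by simp

lemma bpow_l [simp]: "(b ^^ i) l = l"
  by (induction i) simp_all

lemma Npow_2n: "x \<in> U \<Longrightarrow> (N ^^ (2 * n)) x = 0"
  using Npow_top[of x] n_ge N_Npow[of "2 * n - 1" x] by (simp add: N_scale)

lemma bij_b: "bij_betw b U U"
proof -
  have "inj_on b U"
  proof (rule inj_onI)
    fix x y assume xy: "x \<in> U" "y \<in> U" "b x = b y"
    have "x - y = 0"
    proof (rule nondeg)
      fix z assume "z \<in> U"
      then show "\<omega> (x - y) z = 0" using b_form[of "x - y" z] xy by (simp add: U_closed)
    qed (use xy in \<open>auto intro: U_closed\<close>)
    then show "x = y" by simp
  qed
  moreover have "b ` U \<subseteq> U" using b_U by blast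
  ultimately show ?thesis using U_fin endo_inj_surj bij_betw_def by metis
qed

lemma bij_bpow: "bij_betw (b ^^ i) U U"
  using bij_b by (induction i) (auto intro: bij_betw_trans simp: bij_betw_id_iff)

lemma bpow_surj: assumes "y \<in> U" obtains x where "x \<in> U" "(b ^^ i) x = y"
  using bij_bpow[of i] assms unfolding bij_betw_def by (metis imageE)

lemma bpow_form: "x \<in> U \<Longrightarrow> y \<in> U \<Longrightarrow> \<omega> ((b ^^ i) x) ((b ^^ i) y) = \<omega> x y"
  by (induction i) (simp_all add: b_form bpow_U)

section \<open>Moving powers of \<open>N\<close> across the form\<close>

lemma form_N_b: "x \<in> U \<Longrightarrow> y \<in> U \<Longrightarrow> \<omega> (N x) (b y) = - \<omega> x (N y)"
  unfolding N_def by (simp add: b_form)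

text \<open>Each transfer of \<open>N\<close> to the other argument costs a sign and a factor
  \<open>b\<close>, the adjoint of \<open>N\<close> being \<open>- N b^-1\<close>. Powers of
  \<open>b\<close> commute with \<open>N\<close>, so the rule iterates.\<close>

lemma form_Npow_bpow:
  "x \<in> U \<Longrightarrow> y \<in> U \<Longrightarrow> \<omega> ((N ^^ i) x) ((b ^^ i) y) = (- 1) ^ i * \<omega> x ((N ^^ i) y)"
proof (induction i arbitrary: y)
  case (Suc i)
  have "\<omega> ((N ^^ Suc i) x) ((b ^^ Suc i) y) = - \<omega> ((N ^^ i) x) (N ((b ^^ i) y))"
    using form_N_b Suc.prems by (simp add: Npow_U bpow_U)
  also have "\<dots> = - \<omega> ((N ^^ i) x) ((b ^^ i) (N y))"
    using bpow_Npow[of i 1 y] by simp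
  also have "\<dots> = (- 1) ^ Suc i * \<omega> x ((N ^^ Suc i) y)"
    using Suc by (simp add: N_U funpow_swap1)
  finally show ?case .
qed simp

lemma N_L: "x \<in> U \<Longrightarrow> N x \<in> L"
  unfolding L_def using form_N_b[of x l] by (simp add: N_U l_U)

lemma Npow_L: "x \<in> U \<Longrightarrow> i > 0 \<Longrightarrow> (N ^^ i) x \<in> L"
  using N_L[OF Npow_U[of x "i - 1"]] by (cases i) simp_all

lemma b_L: "x \<in> L \<Longrightarrow> b x \<in> L"
  unfolding L_def using b_form[of x l] b_U l_U by auto

section \<open>Kernels of the powers of \<open>N\<close>\<close>

definition Ker where "Ker i = {v \<in> U. (N ^^ i) v = 0}"

lemma finite_Ker: "finite (Ker i)"
  unfolding Ker_def using U_fin by simp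

text \<open>The vector \<open>y\<close> below lies in \<open>Ker (Suc i)\<close> and not in
  \<open>Ker i\<close>, since \<open>N\<close> takes it to \<open>\<kappa> *s l\<close> in
  \<open>i\<close> steps. Its multiples give disjoint translates of \<open>Ker i\<close>.\<close>

lemma card_Ker_Suc:
  assumes i: "i < 2 * n"
  shows "CARD('a) * card (Ker i) \<le> card (Ker (Suc i))"
proof -
  obtain x where x: "x \<in> U" "\<omega> x l = 1" using ex_dual_l .
  define y where "y = (N ^^ (2 * n - 1 - i)) x"
  have y: "y \<in> U" "(N ^^ i) y = \<kappa> *s l"
    using x i by (simp_all add: y_def Npow_U Npow_Npow Npow_top del: One_nat_def)
  have yS: "(N ^^ Suc i) y = 0" using y by (simp add: N_scale)
  have "inj_on (\<lambda>(c, z). c *s y + z) (UNIV \<times> Ker i)"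
  proof (rule inj_onI, clarify)
    fix c z c' z'
    assume z: "z \<in> Ker i" "z' \<in> Ker i" and eq: "c *s y + z = c' *s y + z'"
    have "(N ^^ i) (c *s y + z) = (N ^^ i) (c' *s y + z')" using eq by simp
    then have "c *s \<kappa> *s l = c' *s \<kappa> *s l" using z y unfolding Ker_def by simp
    then have "c = c'" using \<kappa>_nz l_nz by simp
    then show "c = c' \<and> z = z'" using eq by simp
  qed
  then have "card ((\<lambda>(c, z). c *s y + z) ` (UNIV \<times> Ker i)) = CARD('a) * card (Ker i)"
    by (simp add: card_image card_cartesian_product)
  moreover have "(\<lambda>(c, z). c *s y + z) ` (UNIV \<times> Ker i) \<subseteq> Ker (Suc i)"
    using y yS unfolding Ker_def by (auto intro: U_closed simp: N_add N_scale)
  ultimately show ?thesis using card_mono[OF finite_Ker] by metis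
qed

lemma card_Ker: "i < 2 * n \<Longrightarrow> CARD('a) ^ i * card (Ker 1) \<le> card (Ker (Suc i))"
proof (induction i)
  case (Suc i)
  have "CARD('a) ^ Suc i * card (Ker 1) \<le> CARD('a) * card (Ker (Suc i))"
    using Suc by (simp add: mult.assoc)
  also have "\<dots> \<le> card (Ker (Suc (Suc i)))"
    using card_Ker_Suc Suc.prems by blast
  finally show ?case .
qed simp

text \<open>Each of the \<open>2 * n - 1\<close> steps from \<open>Ker 1\<close> to
  \<open>Ker (2 * n) = U\<close> multiplies the size by at least \<open>CARD('a)\<close>, which
  leaves room only for a line. Thus \<open>N\<close> is a single Jordan block.\<close>

lemma ker_N: "v \<in> U \<Longrightarrow> N v = 0 \<Longrightarrow> v \<in> Fl"
proof -
  have "Ker (2 * n) = U" unfolding Ker_def using Npow_2n by auto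
  then have "CARD('a) ^ (2 * n - 1) * card (Ker 1) \<le> CARD('a) ^ (2 * n)"
    using card_Ker[of "2 * n - 1"] n_ge U_card by simp
  also have "\<dots> = CARD('a) ^ (2 * n - 1) * CARD('a)"
    using n_ge by (simp flip: power_Suc2)
  finally have "card (Ker 1) \<le> CARD('a)" by simp
  moreover have "card Fl = CARD('a)"
    unfolding Fl_def using l_nz by (intro card_image injI) simp
  moreover have "Fl \<subseteq> Ker 1"
    unfolding Fl_def Ker_def by (auto intro: U_closed simp: N_scale)
  ultimately have "Fl = Ker 1" using card_seteq[OF finite_Ker] by metis
  then show "v \<in> U \<Longrightarrow> N v = 0 \<Longrightarrow> v \<in> Fl" unfolding Ker_def by auto
qed

text \<open>By \<open>ker_N\<close>, \<open>(N ^^ i) v\<close> is a multiple of \<open>l\<close>, as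
  is the image of \<open>(N ^^ j) x\<close> when \<open>i + j = 2 * n - 1\<close>. Subtracting a
  suitable multiple of the latter from \<open>v\<close> lowers the exponent by one.\<close>

lemma ker_Npow_eq_im:
  "v \<in> U \<Longrightarrow> (N ^^ i) v = 0 \<Longrightarrow> i \<le> 2 * n \<Longrightarrow> \<exists>y\<in>U. v = (N ^^ (2 * n - i)) y"
proof (induction i arbitrary: v)
  case 0
  then show ?case using U_closed by (auto intro!: bexI[of _ 0])
next
  case (Suc i)
  obtain x where x: "x \<in> U" "\<omega> x l = 1" using ex_dual_l .
  define j where "j = 2 * n - Suc i"
  have j: "i + j = 2 * n - 1" "2 * n - i = Suc j" using Suc.prems by (auto simp: j_def)
  have "(N ^^ i) v \<in> Fl" using ker_N[of "(N ^^ i) v"] Suc.prems Npow_U by simp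
  then obtain c where c: "(N ^^ i) v = c *s l" unfolding Fl_def by blast
  define w where "w = v - (c / \<kappa>) *s (N ^^ j) x"
  have "(N ^^ i) w = 0"
    unfolding w_def using c x \<kappa>_nz by (simp add: Npow_Npow j Npow_top del: One_nat_def)
  moreover have "w \<in> U" unfolding w_def using x Suc.prems by (intro U_closed Npow_U)
  ultimately obtain y where y: "y \<in> U" "w = (N ^^ (2 * n - i)) y"
    using Suc.IH Suc.prems by auto
  have "v = (N ^^ j) ((c / \<kappa>) *s x + N y)"
    using y(2) unfolding w_def j by (simp add: algebra_simps funpow_swap1)
  then show ?case using x y
    by (intro bexI[of _ "(c / \<kappa>) *s x + N y"]) (auto simp: j_def intro!: U_closed N_U)
qed

section \<open>The quadratic form \<open>\<omega> v (b v)\<close>\<close>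

lemma form_b_eq_N: "\<omega> v (b v) = \<omega> v (N v)"
  unfolding N_def by simp

text \<open>Moving \<open>n - 1\<close> powers of \<open>N\<close> to the right assembles the top
  power \<open>2 * n - 1\<close>, which is known. Writing \<open>y\<close> as a power of
  \<open>b\<close> applied to \<open>z\<close> supplies the factors of \<open>b\<close> for the
  transfer, and \<open>z\<close> pairs with \<open>l\<close> as \<open>y\<close> does.\<close>

lemma form_middle:
  assumes y: "y \<in> U"
  shows "\<omega> ((N ^^ (n - 1)) y) (b ((N ^^ (n - 1)) y)) = (- 1) ^ (n - 1) * (\<kappa> * (\<omega> y l)\<^sup>2)"
proof -
  obtain z where z: "z \<in> U" "(b ^^ (n - 1)) z = y" using bpow_surj[OF y] .
  have zl: "\<omega> z l = \<omega> y l" using bpow_form[OF z(1) l_U, of "n - 1"] z by simp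
  have "N ((N ^^ (n - 1)) y) = (b ^^ (n - 1)) ((N ^^ n) z)"
    using n_ge z N_Npow[of "n - 1" y] by (simp add: bpow_Npow)
  then have "\<omega> ((N ^^ (n - 1)) y) (b ((N ^^ (n - 1)) y))
      = (- 1) ^ (n - 1) * \<omega> y ((N ^^ (n - 1)) ((N ^^ n) z))"
    using form_Npow_bpow[OF y Npow_U[OF z(1)]] by (simp add: form_b_eq_N)
  also have "(N ^^ (n - 1)) ((N ^^ n) z) = (\<kappa> * \<omega> z l) *s l"
    using n_ge Npow_top[OF z(1)] by (simp add: Npow_Npow mult_2)
  finally show ?thesis by (simp add: zl power2_eq_square mult_ac)
qed

text \<open>The polarisation of the quadratic form at \<open>v\<close> and
  \<open>(N ^^ n) y\<close>, rewritten so that it depends on \<open>v\<close> only through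
  \<open>(N ^^ (n + 1)) v\<close>.\<close>

definition \<psi> where "\<psi> v y = (- 1) ^ (n + 1) * \<omega> ((N ^^ (n + 1)) v) ((b ^^ n) (b y + y))"

lemma form_shift:
  assumes v: "v \<in> U" and y: "y \<in> U"
  shows "\<omega> (v + (N ^^ n) y) (b (v + (N ^^ n) y)) = \<omega> v (b v) + \<psi> v y"
proof -
  define z where "z = (N ^^ n) y"
  \<comment> \<open>\<open>N y\<close> lies in \<open>L\<close>, so \<open>form_middle\<close> shows
    that the image of \<open>N ^^ n\<close> is totally singular.\<close>
  have "z = (N ^^ (n - 1)) (N y)" using n_ge by (simp add: z_def Npow_N)
  then have zz: "\<omega> z (N z) = 0"
    using form_middle[OF N_U[OF y]] L_l[OF N_L[OF y]] by (simp add: form_b_eq_N)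
  have 1: "\<omega> v (N z) = (- 1) ^ (n + 1) * \<omega> ((N ^^ (n + 1)) v) ((b ^^ (n + 1)) y)"
    using form_Npow_bpow[OF v y, of "n + 1"] by (simp add: z_def flip: mult.assoc power_mult_distrib)
  have "\<omega> (N v) z = (- 1) ^ n * \<omega> ((N ^^ (n + 1)) v) ((b ^^ n) y)"
    using form_Npow_bpow[OF N_U[OF v] y, of n]
    by (simp add: z_def funpow_swap1 flip: mult.assoc power_mult_distrib)
  then have 2: "\<omega> z (N v) = (- 1) ^ (n + 1) * \<omega> ((N ^^ (n + 1)) v) ((b ^^ n) y)"
    using form_anti[of z "N v"] by simp
  have "\<omega> (v + z) (N (v + z)) = \<omega> v (N v) + (\<omega> v (N z) + \<omega> z (N v))"
    using zz by (simp add: N_add algebra_simps)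
  also have "\<omega> v (N z) + \<omega> z (N v) = \<psi> v y"
    unfolding 1 2 \<psi>_def by (simp add: funpow_swap1 algebra_simps)
  finally show ?thesis unfolding form_b_eq_N z_def .
qed

text \<open>A kernel vector would be an eigenvector of the nilpotent \<open>N\<close> with
  eigenvalue \<open>- 2\<close>, which is nonzero.\<close>

lemma bij_b_plus_1: "bij_betw (\<lambda>y. b y + y) U U"
proof -
  have "inj_on (\<lambda>y. b y + y) U"
  proof (rule inj_onI)
    fix x y assume xy: "x \<in> U" "y \<in> U" "b x + x = b y + y"
    define z where "z = x - y"
    have "b z + z = 0" using xy(3) unfolding z_def by (simp add: algebra_simps)
    then have "b z = - z" by (simp add: eq_neg_iff_add_eq_0)
    moreover have "(2::'a) *s z = z + z"
      using scale_left_distrib[of 1 1 z] by simp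
    ultimately have Nz: "N z = (- 2) *s z"
      unfolding N_def by simp
    have "(N ^^ i) z = (- 2) ^ i *s z" for i
      by (induction i) (simp_all add: N_scale Nz mult_ac)
    then have "(- 2) ^ (2 * n) *s z = 0"
      using Npow_2n[of z] xy by (metis z_def subspace_diff[OF U_sub])
    then have "z = 0" using two_nz by simp
    then show "x = y" by (simp add: z_def)
  qed
  moreover have "(\<lambda>y. b y + y) ` U \<subseteq> U" by (auto intro: U_closed b_U)
  ultimately show ?thesis using U_fin endo_inj_surj bij_betw_def by metis
qed

end

section \<open>The character sum of a single root\<close>

locale symp_root_char = symp_root scale U \<omega> l n b \<kappa> + quadratic_char \<chi>
  for scale :: "'a::{field,finite} \<Rightarrow> 'v::ab_group_add \<Rightarrow> 'v" (infixr "*s" 75)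
    and U \<omega> l n b \<kappa> and \<chi> :: "'a \<Rightarrow> int"
begin

text \<open>The shifts by the isotropic subspace \<open>im N\<^sup>n\<close> change the quadratic form \<open>\<omega>(v, b v)\<close> by a linear
  functional, which vanishes only for \<open>v \<in> ker N\<^sup>n\<^sup>+\<^sup>1\<close>.\<close>

lemma average_shift:
  assumes v: "v \<in> U"
  shows "(\<Sum>y\<in>U. \<chi> (\<omega> (v + (N ^^ n) y) (b (v + (N ^^ n) y))))
    = (if (N ^^ (n + 1)) v = 0 then int (card U) * \<chi> (\<omega> v (b v)) else 0)"
proof -
  have eq: "(\<Sum>y\<in>U. \<chi> (\<omega> (v + (N ^^ n) y) (b (v + (N ^^ n) y))))
      = (\<Sum>y\<in>U. \<chi> (\<omega> v (b v) + \<psi> v y))"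
  proof (rule sum.cong[OF refl])
    fix y assume "y \<in> U"
    show "\<chi> (\<omega> (v + (N ^^ n) y) (b (v + (N ^^ n) y))) = \<chi> (\<omega> v (b v) + \<psi> v y)"
      unfolding form_shift[OF v \<open>y \<in> U\<close>] by (rule refl)
  qed
  show ?thesis
  proof (cases "(N ^^ (n + 1)) v = 0")
    case True
    then have "\<psi> v y = 0" for y unfolding \<psi>_def by simp
    then show ?thesis unfolding eq using True by simp
  next
    case False
    \<comment> \<open>The prescribed value cancels the sign in \<psi> and gives
      \<open>\<psi> v x = 1\<close> below. Adding \<open>t *s x\<close> to \<open>y\<close> then
      raises \<open>\<psi> v y\<close> by \<open>t\<close>.\<close>
    obtain w where w: "w \<in> U" "\<omega> ((N ^^ (n + 1)) v) w = (- 1) ^ (n + 1)"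
      using dual[OF Npow_U[OF v] False] .
    obtain z where z: "z \<in> U" "(b ^^ n) z = w" using bpow_surj[OF w(1)] .
    have "z \<in> (\<lambda>y. b y + y) ` U"
      using bij_b_plus_1 z(1) unfolding bij_betw_def by blast
    then obtain x where x: "x \<in> U" "b x + x = z" by auto
    have "((- 1) ^ (n + 1) :: 'a) * (- 1) ^ (n + 1) = 1"
      by (simp only: power_mult_distrib[symmetric]) simp
    then have \<psi>x: "\<psi> v x = 1" unfolding \<psi>_def x z w .
    have \<psi>_lin: "\<psi> v (y + t *s x) = \<psi> v y + t" for y t
    proof -
      have "(b ^^ n) (b (y + t *s x) + (y + t *s x))
          = (b ^^ n) (b y + y) + t *s (b ^^ n) (b x + x)"
        by (simp add: algebra_simps)
      then have "\<psi> v (y + t *s x) = \<psi> v y + t * \<psi> v x"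
        unfolding \<psi>_def by (simp only: form_add_right form_scale_right) (simp add: algebra_simps)
      then show ?thesis by (simp add: \<psi>x)
    qed
    have "(\<Sum>y\<in>U. \<chi> (\<omega> v (b v) + \<psi> v y)) = 0"
    proof (rule sum_chi_equidistributed[where \<pi> = "\<lambda>t y. y + t *s x"])
      show "bij_betw (\<lambda>y. y + t *s x) U U" for t
        by (rule bij_betw_byWitness[where f' = "\<lambda>y. y - t *s x"]) (use x in \<open>auto intro: U_closed\<close>)
    qed (simp add: \<psi>_lin)
    then show ?thesis unfolding eq using False by simp
  qed
qed

lemma chi_middle:
  assumes "y \<in> U"
  shows "\<chi> (\<omega> ((N ^^ (n - 1)) y) (b ((N ^^ (n - 1)) y))) = (if \<omega> y l = 0 then 0 else \<chi> \<kappa>)"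
proof (cases "\<omega> y l = 0")
  case False
  then show ?thesis
    unfolding form_middle[OF assms] chi_sign by (simp add: chi_mult power2_eq_square chi_square)
qed (simp only: form_middle[OF assms] chi_sign, simp)

text \<open>Averaging over shifts by the image of \<open>N ^^ n\<close> leaves only the vectors of
  \<open>L\<close> killed by \<open>N ^^ (n + 1)\<close>. They have the form
  \<open>(N ^^ (n - 1)) y\<close>, where \<open>chi_middle\<close> gives 0 or
  \<open>\<chi> \<kappa>\<close>, and \<open>y = x\<close> gives a nonzero term.\<close>

lemma sum_chi_form_pos: "\<chi> \<kappa> * (\<Sum>v\<in>L. \<chi> (\<omega> v (b v))) > 0"
proof -
  define Q where "Q v = \<chi> (\<omega> v (b v))" for v
  let ?M = "{v \<in> L. (N ^^ (n + 1)) v = 0}"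
  have n: "n > 0" "n - 1 > 0" using n_ge by auto
  have "int (card U) * (\<Sum>v\<in>L. Q v) = (\<Sum>y\<in>U. \<Sum>v\<in>L. Q v)" by simp
  also have "\<dots> = (\<Sum>y\<in>U. \<Sum>v\<in>L. Q (v + (N ^^ n) y))"
  proof (rule sum.cong[OF refl])
    fix y assume "y \<in> U"
    then have y: "(N ^^ n) y \<in> L" using Npow_L n by blast
    show "(\<Sum>v\<in>L. Q v) = (\<Sum>v\<in>L. Q (v + (N ^^ n) y))"
      by (rule sum.reindex_bij_witness[of _ "\<lambda>v. v + (N ^^ n) y" "\<lambda>v. v - (N ^^ n) y"])
        (use y in \<open>auto intro: L_closed\<close>)
  qed
  also have "\<dots> = (\<Sum>v\<in>L. \<Sum>y\<in>U. Q (v + (N ^^ n) y))" by (rule sum.swap)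
  also have "\<dots> = (\<Sum>v\<in>L. if (N ^^ (n + 1)) v = 0 then int (card U) * Q v else 0)"
    unfolding Q_def by (intro sum.cong refl average_shift L_U)
  also have "\<dots> = (\<Sum>v\<in>?M. int (card U) * Q v)"
    using finite_L by (simp add: sum.inter_filter)
  finally have "int (card U) * (\<Sum>v\<in>L. Q v) = int (card U) * (\<Sum>v\<in>?M. Q v)"
    by (simp add: sum_distrib_left)
  moreover have "card U \<noteq> 0" using U_fin l_U by auto
  ultimately have eq: "(\<Sum>v\<in>L. Q v) = (\<Sum>v\<in>?M. Q v)" by simp
  obtain x where x: "x \<in> U" "\<omega> x l = 1" using ex_dual_l .
  have "(\<Sum>v\<in>?M. \<chi> \<kappa> * Q v) > 0"
  proof (rule sum_pos2)
    show "finite ?M" using finite_L by simp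
    have "(N ^^ (n + 1)) ((N ^^ (n - 1)) x) = 0"
      using Npow_2n[OF x(1)] n by (simp add: Npow_Npow mult_2 del: funpow.simps)
    then show "(N ^^ (n - 1)) x \<in> ?M" using Npow_L[OF x(1) n(2)] by blast
    show "0 < \<chi> \<kappa> * Q ((N ^^ (n - 1)) x)"
      unfolding Q_def chi_middle[OF x(1)] using chi_square \<kappa>_nz x by simp
    fix v assume v: "v \<in> ?M"
    have "\<exists>y\<in>U. v = (N ^^ (2 * n - (n + 1))) y"
      by (rule ker_Npow_eq_im) (use v L_U n in \<open>auto simp del: funpow.simps\<close>)
    moreover have "2 * n - (n + 1) = n - 1" by simp
    ultimately obtain y where y: "y \<in> U" "v = (N ^^ (n - 1)) y" by metis
    show "0 \<le> \<chi> \<kappa> * Q v"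
      unfolding Q_def y chi_middle[OF y(1)] using chi_square \<kappa>_nz by simp
  qed
  then show ?thesis using eq by (simp add: Q_def sum_distrib_left)
qed

end

subsection \<open>Conjugation-invariant sets of roots\<close>

text \<open>The roots are given through their action alone; \<open>R_conj\<close> expresses closure
  under conjugation by transvections that fix \<open>l\<close>.\<close>

locale symp_roots = symp_space scale U \<omega> l n + quadratic_char \<chi>
  for scale :: "'a::{field,finite} \<Rightarrow> 'v::ab_group_add \<Rightarrow> 'v" (infixr "*s" 75)
    and U \<omega> l n and \<chi> :: "'a \<Rightarrow> int" +
  fixes R :: "'g set" and act :: "'g \<Rightarrow> 'v \<Rightarrow> 'v" and \<kappa> :: 'a
  assumes R_fin: "finite R"
    and R_root: "a \<in> R \<Longrightarrow> symp_root scale U \<omega> l n (act a) \<kappa>"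
    and R_conj: "x \<in> L \<Longrightarrow> \<exists>\<rho>. bij_betw \<rho> R R \<and>
      (\<forall>a\<in>R. \<forall>v\<in>U. act (\<rho> a) v = transv x c (act a (transv x (- c) v)))"
begin

lemma R_root_char: "a \<in> R \<Longrightarrow> symp_root_char scale U \<omega> l n (act a) \<kappa> \<chi>"
  by (intro symp_root_char.intro R_root quadratic_char_axioms)

lemmas act_add = symp_root.b_add[OF R_root]
  and act_scale = symp_root.b_scale[OF R_root]
  and act_U = symp_root.b_U[OF R_root]
  and act_L = symp_root.b_L[OF R_root]
  and act_l = symp_root.b_l[OF R_root]

text \<open>Restricting the actions to \<open>U\<close> makes the conjugation identity, which is known only there, an
  equation between functions.\<close>

lemma sum_R_conj:
  assumes "x \<in> L"
  shows "(\<Sum>a\<in>R. f (\<lambda>v. if v \<in> U then transv x c (act a (transv x (- c) v)) else 0))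
    = (\<Sum>a\<in>R. f (\<lambda>v. if v \<in> U then act a v else 0))"
proof -
  obtain \<rho> where \<rho>: "bij_betw \<rho> R R"
    "\<And>a v. a \<in> R \<Longrightarrow> v \<in> U \<Longrightarrow> act (\<rho> a) v = transv x c (act a (transv x (- c) v))"
    using R_conj[OF assms] by blast
  have "(\<Sum>a\<in>R. f (\<lambda>v. if v \<in> U then act a v else 0))
      = (\<Sum>a\<in>R. f (\<lambda>v. if v \<in> U then act (\<rho> a) v else 0))"
    by (rule sum.reindex_bij_betw[OF \<rho>(1), symmetric])
  also have "\<dots> = (\<Sum>a\<in>R. f (\<lambda>v. if v \<in> U then transv x c (act a (transv x (- c) v)) else 0))"
  proof (rule sum.cong[OF refl])
    fix a assume "a \<in> R"
    then have "(\<lambda>v. if v \<in> U then act (\<rho> a) v else 0)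
        = (\<lambda>v. if v \<in> U then transv x c (act a (transv x (- c) v)) else 0)"
      using \<rho>(2) by auto
    then show "f (\<lambda>v. if v \<in> U then act (\<rho> a) v else 0)
        = f (\<lambda>v. if v \<in> U then transv x c (act a (transv x (- c) v)) else 0)" by simp
  qed
  finally show ?thesis by simp
qed

section \<open>Character sums over all roots\<close>

definition F where "F v w = (\<Sum>a\<in>R. \<chi> (\<omega> w (act a v)))"

lemma F_transv:
  assumes x: "x \<in> L" and v: "v \<in> U"
  shows "F (transv x c v) (transv x c w) = F v w"
proof -
  have "F (transv x c v) (transv x c w)
      = (\<Sum>a\<in>R. \<chi> (\<omega> (transv x c w) (transv x c (act a (transv x (- c) (transv x c v))))))"
    unfolding F_def
    using sum_R_conj[OF x, of "\<lambda>h. \<chi> (\<omega> (transv x c w) (h (transv x c v)))" c]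
      transv_U[OF L_U[OF x] v] by simp
  then show ?thesis by (simp add: F_def transv_form)
qed

definition h where "h v = int (card {a \<in> R. act a v - v \<in> Fl})"

lemma h_sum: "h v = (\<Sum>a\<in>R. if act a v - v \<in> Fl then 1 else 0)"
  unfolding h_def using R_fin by (simp add: sum.If_cases Int_def)

lemma transv_Fl: "x \<in> L \<Longrightarrow> y \<in> Fl \<Longrightarrow> transv x c y \<in> Fl"
  unfolding Fl_def by (auto simp: transv_scale transv_l)

lemma h_transv:
  assumes x: "x \<in> L" and v: "v \<in> U"
  shows "h (transv x c v) = h v"
proof -
  have d: "transv x c (y - z) = transv x c y - transv x c z" for y z
    using transv_add[of x c y "(- 1) *s z"] transv_scale[of x c "- 1" z] by simp
  have iff: "transv x c y \<in> Fl \<longleftrightarrow> y \<in> Fl" for y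
    using transv_Fl[OF x, of y c] transv_Fl[OF x, of "transv x c y" "- c"] by auto
  have "h (transv x c v)
      = (\<Sum>a\<in>R. if transv x c (act a (transv x (- c) (transv x c v))) - transv x c v \<in> Fl then 1 else 0)"
    unfolding h_sum
    using sum_R_conj[OF x, of "\<lambda>g. if g (transv x c v) - transv x c v \<in> Fl then 1 else 0" c, symmetric]
      transv_U[OF L_U[OF x] v] by simp
  also have "\<dots> = h v" by (simp add: h_sum iff flip: d)
  finally show ?thesis .
qed

text \<open>The transvection along \<open>y\<close> that carries \<open>w\<close> to
  \<open>w + y\<close> fixes \<open>v\<close>, because \<open>v\<close> is orthogonal to
  \<open>y\<close>.\<close>

lemma F_shift:
  assumes v: "v \<in> U" and y: "y \<in> K v" and nz: "\<omega> w y \<noteq> 0"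
  shows "F v (w + y) = F v w"
proof -
  have "transv y (1 / \<omega> w y) v = v" "transv y (1 / \<omega> w y) w = w + y"
    using K_form[OF y] nz unfolding transv_def by simp_all
  then show ?thesis using F_transv[OF K_L[OF y] v, of "1 / \<omega> w y" w] by simp
qed

lemma F_scale: "F v (c *s w) = \<chi> c * F v w"
  unfolding F_def by (simp add: chi_mult sum_distrib_left)

text \<open>\<open>act a\<close> is unipotent, and \<alpha> is its eigenvalue on the plane of
  \<open>v\<close> and \<open>l\<close> modulo the line of \<open>l\<close>.\<close>

lemma act_span_imp_fixed:
  assumes a: "a \<in> R" and v: "v \<in> L" "v \<notin> Fl" and av: "act a v = \<alpha> *s v + \<beta> *s l"
  shows "\<alpha> = 1"
proof -
  interpret symp_root scale U \<omega> l n "act a" \<kappa> by (rule R_root[OF a])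
  have "\<exists>\<gamma>. (N ^^ i) v = (\<alpha> - 1) ^ i *s v + \<gamma> *s l" for i
  proof (induction i)
    case (Suc i)
    then obtain \<gamma> where "(N ^^ i) v = (\<alpha> - 1) ^ i *s v + \<gamma> *s l" by blast
    moreover have "N v = (\<alpha> - 1) *s v + \<beta> *s l"
      unfolding N_def av by (simp add: algebra_simps)
    ultimately have "(N ^^ Suc i) v = (\<alpha> - 1) ^ Suc i *s v + ((\<alpha> - 1) ^ i * \<beta>) *s l"
      by (simp add: N_add N_scale scale_right_distrib mult.commute)
    then show ?case by blast
  qed (auto intro: exI[of _ 0])
  then obtain \<gamma> where \<gamma>: "(\<alpha> - 1) ^ (2 * n) *s v + \<gamma> *s l = 0"
    using Npow_2n[OF L_U[OF v(1)]] by metis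
  show ?thesis
  proof (rule ccontr)
    assume "\<alpha> \<noteq> 1"
    define c where "c = (\<alpha> - 1) ^ (2 * n)"
    have nz: "c \<noteq> 0" using \<open>\<alpha> \<noteq> 1\<close> by (simp add: c_def)
    have "c *s v = (- \<gamma>) *s l" using \<gamma> by (simp add: add_eq_0_iff2 c_def)
    then have "(1 / c) *s c *s v = (1 / c) *s (- \<gamma>) *s l" by simp
    then have "v = (1 / c * - \<gamma>) *s l" using nz unfolding scale_scale by simp
    then show False using v(2) unfolding Fl_def by blast
  qed
qed

text \<open>Pairing \<open>y\<close> with \<open>act a v\<close> is a linear functional on
  \<open>K v\<close>. The sum vanishes unless this functional is zero, and then
  \<open>perp_K\<close> puts \<open>act a v\<close> in the plane of \<open>v\<close> and
  \<open>l\<close>.\<close>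

lemma sum_chi_K:
  assumes v: "v \<in> L" "v \<notin> Fl" and a: "a \<in> R" and w: "w \<in> L"
  shows "(\<Sum>y\<in>K v. \<chi> (\<omega> (w + y) (act a v)))
    = (if act a v - v \<in> Fl then int (card (K v)) * \<chi> (\<omega> w v) else 0)"
proof (cases "\<forall>y\<in>K v. \<omega> y (act a v) = 0")
  case True
  have "\<omega> (act a v) y = 0" if "y \<in> K v" for y
    using True that form_anti[of "act a v" y] by simp
  then obtain \<alpha> \<beta> where av: "act a v = \<alpha> *s v + \<beta> *s l"
    using perp_K[OF v act_U[OF a L_U[OF v(1)]]] by blast
  have "\<alpha> = 1" by (rule act_span_imp_fixed[OF a v av])
  then have "act a v - v \<in> Fl" "\<omega> w (act a v) = \<omega> w v"
    using av L_l[OF w] by simp_all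
  then show ?thesis using True by simp
next
  case False
  then obtain y where y: "y \<in> K v" "\<omega> y (act a v) \<noteq> 0" by blast
  define x where "x = (1 / \<omega> y (act a v)) *s y"
  have x: "x \<in> K v" "\<omega> x (act a v) = 1"
    using y unfolding x_def by (auto intro: K_closed)
  have "act a v - v \<notin> Fl"
  proof
    assume "act a v - v \<in> Fl"
    then obtain \<beta> where "act a v - v = \<beta> *s l" unfolding Fl_def by blast
    then have "act a v = v + \<beta> *s l" by (simp add: algebra_simps)
    then have "\<omega> y (act a v) = \<omega> y v + \<beta> * \<omega> y l" by simp
    then show False using y K_form[OF y(1)] L_l[OF K_L[OF y(1)]] form_anti[of y v] by simp
  qed
  moreover have "(\<Sum>y\<in>K v. \<chi> (\<omega> (w + y) (act a v))) = 0"
  proof (rule sum_chi_equidistributed[where \<pi> = "\<lambda>t y. y + t *s x"])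
    show "bij_betw (\<lambda>y. y + t *s x) (K v) (K v)" for t
      by (rule bij_betw_byWitness[where f' = "\<lambda>y. y - t *s x"]) (use x in \<open>auto intro: K_closed\<close>)
  qed (use x in simp)
  ultimately show ?thesis by simp
qed

text \<open>\<open>F v\<close> is constant on the coset \<open>w + K v\<close>, hence equal to its
  average there, which \<open>sum_chi_K\<close> evaluates root by root.\<close>

lemma F_nonorthogonal:
  assumes v: "v \<in> L" "v \<notin> Fl" and w: "w \<in> L" and nz: "\<omega> w v \<noteq> 0"
  shows "F v w = h v * \<chi> (\<omega> w v)"
proof -
  have vK: "v \<in> K v" using v unfolding K_def by simp
  have inv: "F v (w + y) = F v w" if y: "y \<in> K v" for y
  proof (cases "\<omega> w y = 0")
    case False
    then show ?thesis using F_shift[OF L_U[OF v(1)] y] by simp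
  next
    case True
    have yv: "\<omega> y v = 0" using K_form[OF y] form_anti[of y v] by simp
    \<comment> \<open>\<open>F_shift\<close> does not apply to \<open>y\<close> directly. The
      partial shifts by \<open>y - v\<close> and by \<open>v\<close> both have nonzero pairing with
      the point they start from.\<close>
    have "F v (w + (y - v)) = F v w"
      by (rule F_shift) (use L_U v K_closed y vK True nz in auto)
    moreover have "F v (w + (y - v) + v) = F v (w + (y - v))"
      by (rule F_shift) (use L_U v vK nz yv in auto)
    ultimately show ?thesis by (simp add: algebra_simps)
  qed
  have "int (card (K v)) * F v w = (\<Sum>y\<in>K v. F v (w + y))"
    by (simp add: inv)
  also have "\<dots> = (\<Sum>a\<in>R. \<Sum>y\<in>K v. \<chi> (\<omega> (w + y) (act a v)))"
    unfolding F_def by (rule sum.swap)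
  also have "\<dots> = (\<Sum>a\<in>R. if act a v - v \<in> Fl then int (card (K v)) * \<chi> (\<omega> w v) else 0)"
    by (intro sum.cong refl sum_chi_K v w)
  also have "\<dots> = int (card (K v)) * (h v * \<chi> (\<omega> w v))"
    unfolding h_sum sum_distrib_left sum_distrib_right by (intro sum.cong refl) simp
  finally have "int (card (K v)) * F v w = int (card (K v)) * (h v * \<chi> (\<omega> w v))" .
  moreover have "finite (K v)" using finite_L unfolding K_def by simp
  then have "card (K v) \<noteq> 0" using vK by auto
  ultimately show ?thesis by simp
qed

text \<open>Two shifts inside \<open>K v\<close> lead from \<open>w\<close> to \<open>d *s w\<close>
  with \<open>d\<close> a nonsquare. They preserve \<open>F v\<close>, whereas scaling by
  \<open>d\<close> reverses its sign.\<close>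

lemma F_orthogonal:
  assumes v: "v \<in> L" "v \<notin> Fl" and w: "w \<in> L" and orth: "\<omega> w v = 0"
    and indep: "\<And>\<alpha> \<beta>. w \<noteq> \<alpha> *s v + \<beta> *s l"
  shows "F v w = 0"
proof -
  obtain d where d: "\<chi> d = - 1" using chi_nonsquare by blast
  then have d0: "d \<noteq> 0" by auto
  have wK: "w \<in> K v" using w orth form_anti[of v w] unfolding K_def by simp
  obtain z where z: "z \<in> K v" "\<omega> w z \<noteq> 0"
    using perp_K[OF v L_U[OF w]] indep by metis
  have zw: "\<omega> z w = - \<omega> w z" by (rule form_anti)
  \<comment> \<open>The path runs through \<open>w + z\<close> because \<open>w\<close> is
    orthogonal to its own multiples.\<close>
  have "F v (w + z) = F v w"
    by (rule F_shift) (use v L_U z in auto)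
  moreover have "F v (w + z + ((d - 1) *s w - z)) = F v (w + z)"
  proof (rule F_shift)
    show "(d - 1) *s w - z \<in> K v" using z wK by (intro K_closed)
    have "\<omega> (w + z) ((d - 1) *s w - z) = - (d * \<omega> w z)"
      using zw by (simp add: algebra_simps)
    then show "\<omega> (w + z) ((d - 1) *s w - z) \<noteq> 0" using z d0 by simp
  qed (use v L_U in auto)
  moreover have "w + z + ((d - 1) *s w - z) = d *s w"
    by (simp add: algebra_simps)
  ultimately have "F v (d *s w) = F v w" by simp
  then show ?thesis using d F_scale[of v d w] by simp
qed

lemma F_add_l:
  assumes v: "v \<in> L"
  shows "F v (w + \<beta> *s l) = F v w"
  unfolding F_def using act_L v l_L by (intro sum.cong refl) simp

text \<open>Either \<open>act a v\<close> differs from \<open>v\<close> by a multiple of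
  \<open>l\<close>, and then the second summand is zero, or it lies outside the plane of
  \<open>v\<close> and \<open>l\<close>. There, orthogonality to \<open>v\<close> decides between
  the two evaluations of \<open>F\<close>.\<close>

lemma F_act:
  assumes v: "v \<in> L" "v \<notin> Fl" and a: "a \<in> R"
  shows "F v (act a v) = (if act a v - v \<in> Fl then F v v else 0) + h v * \<chi> (\<omega> v (act a v))"
proof (cases "act a v - v \<in> Fl")
  case True
  then obtain \<beta> where "act a v - v = \<beta> *s l" unfolding Fl_def by blast
  then have "act a v = v + \<beta> *s l" by (simp add: algebra_simps)
  then show ?thesis using True F_add_l[OF v(1)] L_l[OF v(1)] by simp
next
  case False
  show ?thesis
  proof (cases "\<omega> (act a v) v = 0")
    case True
    have "act a v \<noteq> \<alpha> *s v + \<beta> *s l" for \<alpha> \<beta>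
    proof
      assume av: "act a v = \<alpha> *s v + \<beta> *s l"
      then have "\<alpha> = 1" by (rule act_span_imp_fixed[OF a v])
      then show False using False av by simp
    qed
    then show ?thesis
      using F_orthogonal[OF v act_L[OF a v(1)] True] False True form_anti[of v "act a v"] by simp
  next
    case nz: False
    show ?thesis
      using F_nonorthogonal[OF v act_L[OF a v(1)] nz] False form_anti[of v "act a v"] by simp
  qed
qed

section \<open>The double sum over pairs of roots\<close>

definition D where "D = L - Fl"

definition A where "A = (\<Sum>a\<in>R. \<Sum>b\<in>R. \<Sum>v\<in>D. \<chi> (\<omega> (act a v) (act b v)))"

text \<open>Summed over the roots, both terms of \<open>F_act\<close> give
  \<open>h v * F v v\<close>, whence the factor 2.\<close>

lemma A_eq: "A = (\<Sum>v\<in>D. 2 * (h v * F v v))"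
proof -
  have "A = (\<Sum>v\<in>D. \<Sum>a\<in>R. F v (act a v))"
    unfolding A_def F_def
    by (subst sum.swap[of _ D R], intro sum.cong refl sum.swap)
  also have "\<dots> = (\<Sum>v\<in>D. 2 * (h v * F v v))"
  proof (rule sum.cong[OF refl])
    fix v assume "v \<in> D"
    then have v: "v \<in> L" "v \<notin> Fl" unfolding D_def by auto
    have "(\<Sum>a\<in>R. F v (act a v))
        = (\<Sum>a\<in>R. (if act a v - v \<in> Fl then F v v else 0) + h v * \<chi> (\<omega> v (act a v)))"
      by (intro sum.cong refl F_act v)
    also have "\<dots> = (\<Sum>a\<in>R. (if act a v - v \<in> Fl then 1 else 0) * F v v) + h v * F v v"
      unfolding F_def sum.distrib sum_distrib_left
      by (intro arg_cong2[of _ _ _ _ "(+)"] sum.cong refl) simp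
    finally show "(\<Sum>a\<in>R. F v (act a v)) = 2 * (h v * F v v)"
      by (simp add: h_sum flip: sum_distrib_right)
  qed
  finally show ?thesis .
qed

lemma h_pos:
  assumes "R \<noteq> {}"
  obtains v where "v \<in> D" "h v > 0"
proof -
  obtain a where a: "a \<in> R" using assms by blast
  interpret symp_root scale U \<omega> l n "act a" \<kappa> by (rule R_root[OF a])
  obtain x where x: "x \<in> U" "\<omega> x l = 1" using ex_dual_l .
  \<comment> \<open>In the Jordan chain of \<open>x\<close> this vector comes just before the
    multiple of \<open>l\<close>, so the root \<open>a\<close> fixes it modulo
    \<open>Fl\<close>.\<close>
  define v where "v = (N ^^ (2 * n - 2)) x"
  have "N v = (N ^^ (2 * n - 1)) x"
    unfolding v_def N_Npow using n_ge by (intro arg_cong[of _ _ "\<lambda>i. (N ^^ i) x"]) linarith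
  then have Nv: "N v = \<kappa> *s l" using Npow_top x by simp
  have vL: "v \<in> L" unfolding v_def using n_ge x by (intro Npow_L) auto
  moreover have "v \<notin> Fl" using Nv \<kappa>_nz l_nz unfolding Fl_def by (auto simp: N_scale)
  moreover have "a \<in> {a \<in> R. act a v - v \<in> Fl}" using a Nv unfolding N_def by simp
  then have "h v > 0" unfolding h_def using R_fin card_gt_0_iff by fastforce
  ultimately show ?thesis using that unfolding D_def by blast
qed

text \<open>Transvections act transitively on \<open>D\<close>, so \<open>h\<close> is a positive
  constant there and can be taken out. What remains is a sum over the roots of the sums in
  \<open>sum_chi_form_pos\<close>.\<close>

theorem chi_A_pos:
  assumes R: "R \<noteq> {}"
  shows "\<chi> \<kappa> * A > 0"
proof -
  obtain v0 where v0: "v0 \<in> D" "h v0 > 0" using h_pos[OF R] .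
  have "h v = h v0" if "v \<in> D" for v
    by (rule transv_invariant_imp_const) (use h_transv L_U that v0 D_def in auto)
  then have "A = (\<Sum>v\<in>D. 2 * (h v0 * F v v))" unfolding A_eq by simp
  then have "\<chi> \<kappa> * A = 2 * h v0 * (\<chi> \<kappa> * (\<Sum>v\<in>D. F v v))"
    by (simp add: sum_distrib_left mult_ac)
  \<comment> \<open>Multiples of \<open>l\<close> contribute nothing, since every root fixes
    \<open>l\<close>.\<close>
  also have "(\<Sum>v\<in>D. F v v) = (\<Sum>v\<in>L. F v v)"
  proof (rule sum.mono_neutral_left)
    show "\<forall>v\<in>L - D. F v v = 0"
      unfolding D_def Fl_def F_def by (auto simp: act_scale act_l)
  qed (use finite_L D_def in auto)
  also have "\<dots> = (\<Sum>a\<in>R. \<Sum>v\<in>L. \<chi> (\<omega> v (act a v)))"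
    unfolding F_def by (rule sum.swap)
  also have "\<chi> \<kappa> * \<dots> = (\<Sum>a\<in>R. \<chi> \<kappa> * (\<Sum>v\<in>L. \<chi> (\<omega> v (act a v))))"
    by (simp add: sum_distrib_left)
  finally have "\<chi> \<kappa> * A = 2 * h v0 * (\<Sum>a\<in>R. \<chi> \<kappa> * (\<Sum>v\<in>L. \<chi> (\<omega> v (act a v))))" .
  moreover have "(\<Sum>a\<in>R. \<chi> \<kappa> * (\<Sum>v\<in>L. \<chi> (\<omega> v (act a v)))) > 0"
    using symp_root_char.sum_chi_form_pos[OF R_root_char] R R_fin by (intro sum_pos)
  ultimately show ?thesis using v0 by simp
qed

end

lemma sum_fun_apply: "(\<Sum>x\<in>A. f x) i = (\<Sum>x\<in>A. f x i)"
  by (induction A rule: infinite_finite_induct) auto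

subsection \<open>Powers of operators in prime characteristic\<close>

context vector_space
begin

lemma funpow_binomial:
  fixes b :: "'b \<Rightarrow> 'b"
  defines "N \<equiv> \<lambda>v. b v - v"
  assumes add: "\<And>x y. b (x + y) = b x + b y" and scale: "\<And>c x. b (c *s x) = c *s b x"
  shows "(b ^^ k) v = (\<Sum>i\<le>k. of_nat (k choose i) *s (N ^^ i) v)"
proof (induction k)
  case (Suc k)
  have b_eq: "b x = x + N x" for x by (simp add: N_def)
  have b_0: "b 0 = 0" using scale[of 0 0] by simp
  have b_sum: "b (\<Sum>i\<in>S. f i) = (\<Sum>i\<in>S. b (f i))" for f :: "nat \<Rightarrow> 'b" and S
    by (induction S rule: infinite_finite_induct) (simp_all add: add b_0)
  have "(b ^^ Suc k) v = (\<Sum>i\<le>k. of_nat (k choose i) *s ((N ^^ i) v + (N ^^ Suc i) v))"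
    unfolding funpow.simps comp_apply Suc b_sum scale by (simp add: b_eq[of "(N ^^ _) v"])
  also have "\<dots> = (\<Sum>i\<le>k. of_nat (k choose i) *s (N ^^ i) v)
      + (\<Sum>i\<le>k. of_nat (k choose i) *s (N ^^ Suc i) v)"
    by (simp only: scale_right_distrib sum.distrib)
  also have "(\<Sum>i\<le>k. of_nat (k choose i) *s (N ^^ i) v)
      = (\<Sum>i\<le>Suc k. of_nat (k choose i) *s (N ^^ i) v)"
    by (simp add: binomial_eq_0)
  also have "\<dots> = v + (\<Sum>i\<le>k. of_nat (k choose Suc i) *s (N ^^ Suc i) v)"
    by (subst sum.atMost_Suc_shift) simp
  also have "v + (\<Sum>i\<le>k. of_nat (k choose Suc i) *s (N ^^ Suc i) v)
        + (\<Sum>i\<le>k. of_nat (k choose i) *s (N ^^ Suc i) v)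
      = v + (\<Sum>i\<le>k. of_nat (Suc k choose Suc i) *s (N ^^ Suc i) v)"
    by (simp add: add.assoc scale_left_distrib add.commute flip: sum.distrib)
  also have "\<dots> = (\<Sum>i\<le>Suc k. of_nat (Suc k choose i) *s (N ^^ i) v)"
    by (subst sum.atMost_Suc_shift) simp
  finally show ?case .
qed simp

text \<open>The freshman's dream for the commuting operators \<open>1\<close> and \<open>b - 1\<close>.\<close>

lemma funpow_CHAR_power:
  fixes b :: "'b \<Rightarrow> 'b"
  assumes p: "prime p" "CHAR('a) = p"
    and add: "\<And>x y. b (x + y) = b x + b y" and scale: "\<And>c x. b (c *s x) = c *s b x"
  shows "(b ^^ (p ^ j)) v = v + ((\<lambda>v. b v - v) ^^ (p ^ j)) v"
proof (induction j arbitrary: v)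
  case (Suc j)
  define B where "B = b ^^ (p ^ j)"
  have pow: "(b ^^ i) (x + y) = (b ^^ i) x + (b ^^ i) y" "(b ^^ i) (c *s x) = c *s (b ^^ i) x"
    for i x y c by (induction i) (simp_all add: add scale)
  have B_add: "B (x + y) = B x + B y" and B_scale: "B (c *s x) = c *s B x" for x y c
    unfolding B_def by (rule pow)+
  \<comment> \<open>By the induction hypothesis \<open>B - 1\<close> is a power of
    \<open>b - 1\<close>, so only the exponent \<open>p\<close> remains to be treated, now for
    \<open>B\<close>.\<close>
  have N_eq: "(\<lambda>v. B v - v) = (\<lambda>v. b v - v) ^^ (p ^ j)"
    using Suc.IH by (auto simp: B_def fun_eq_iff)
  have "(B ^^ p) v = (\<Sum>i\<le>p. of_nat (p choose i) *s ((\<lambda>v. B v - v) ^^ i) v)"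
    by (rule funpow_binomial) (simp_all add: B_add B_scale)
  also have "\<dots> = (\<Sum>i\<in>{0, p}. of_nat (p choose i) *s ((\<lambda>v. B v - v) ^^ i) v)"
  proof (intro sum.mono_neutral_right ballI)
    fix i assume "i \<in> {..p} - {0, p}"
    then have "p dvd (p choose i)"
      using p by (intro dvd_choose_prime) auto
    then have "of_nat (p choose i) = (0::'a)"
      using of_nat_eq_0_iff_char_dvd p(2) by blast
    then show "of_nat (p choose i) *s ((\<lambda>v. B v - v) ^^ i) v = 0" by simp
  qed auto
  also have "\<dots> = v + ((\<lambda>v. B v - v) ^^ p) v"
    using prime_gt_0_nat[OF p(1)] by simp
  finally show ?case
    unfolding N_eq unfolding B_def funpow_mult by (simp only: power_Suc2)
qed simp

end

subsection \<open>Coordinate vectors\<close>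

definition cscale :: "'a::field \<Rightarrow> (nat \<Rightarrow> 'a) \<Rightarrow> nat \<Rightarrow> 'a" where
  "cscale c v = (\<lambda>i. c * v i)"

text \<open>Vectors of all dimensions share one function type, so that the dimension, which depends
  on \<open>n\<close>, becomes a support condition.\<close>

definition coords :: "nat \<Rightarrow> (nat \<Rightarrow> 'a::field) set" where
  "coords d = {v. \<forall>i\<ge>d. v i = 0}"

definition cunit :: "nat \<Rightarrow> nat \<Rightarrow> 'a::field" where
  "cunit j = (\<lambda>i. if i = j then 1 else 0)"

text \<open>The overall sign is chosen so that pairing with \<open>cunit (n - 1)\<close> on the
  right gives the last coordinate. This makes \<open>g_mat\<close> with corner entry 1 a
  transvection with coefficient 1.\<close>

definition sform :: "nat \<Rightarrow> (nat \<Rightarrow> 'a::field) \<Rightarrow> (nat \<Rightarrow> 'a) \<Rightarrow> 'a" where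
  "sform n v w = (\<Sum>i<n. v (n + i) * w i - v i * w (n + i))"

definition act :: "'a::field mat \<Rightarrow> (nat \<Rightarrow> 'a) \<Rightarrow> nat \<Rightarrow> 'a" where
  "act M v = (\<lambda>i. if i < dim_row M then \<Sum>j<dim_col M. M $$ (i, j) * v j else 0)"

definition mat_of :: "nat \<Rightarrow> ((nat \<Rightarrow> 'a::field) \<Rightarrow> nat \<Rightarrow> 'a) \<Rightarrow> 'a mat" where
  "mat_of d f = mat d d (\<lambda>(i, j). f (cunit j) i)"

lemma cscale_apply: "cscale c v i = c * v i"
  by (simp add: cscale_def)

lemma sum_cunit:
  fixes f :: "nat \<Rightarrow> 'a::field"
  assumes "k < d"
  shows "(\<Sum>j<d. f j * cunit k j) = f k" "(\<Sum>j<d. f j * cunit j k) = f k"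
proof -
  have "(\<Sum>j<d. f j * cunit k j) = (\<Sum>j<d. if j = k then f j else 0)"
    "(\<Sum>j<d. f j * cunit j k) = (\<Sum>j<d. if j = k then f j else 0)"
    by (rule sum.cong; simp add: cunit_def)+
  then show "(\<Sum>j<d. f j * cunit k j) = f k" "(\<Sum>j<d. f j * cunit j k) = f k"
    using assms by simp_all
qed

lemma cunit_in_coords: "j < d \<Longrightarrow> cunit j \<in> coords d"
  by (simp add: cunit_def coords_def)

lemma vector_space_cscale: "vector_space (cscale :: 'a::field \<Rightarrow> _)"
  by unfold_locales (simp_all add: cscale_apply fun_eq_iff algebra_simps)

lemma coords_bij:
  "bij_betw (\<lambda>v. restrict v {..<d}) (coords d) ({..<d} \<rightarrow>\<^sub>E (UNIV :: 'a::field set))"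
proof (rule bij_betw_byWitness[where f' = "\<lambda>v i. if i < d then v i else 0"])
  show "\<forall>v\<in>coords d :: (nat \<Rightarrow> 'a) set. (\<lambda>i. if i < d then restrict v {..<d} i else 0) = v"
    by (intro ballI ext) (simp add: coords_def)
  show "\<forall>v\<in>{..<d} \<rightarrow>\<^sub>E (UNIV :: 'a set). restrict (\<lambda>i. if i < d then v i else 0) {..<d} = v"
  proof (intro ballI ext)
    fix v :: "nat \<Rightarrow> 'a" and i
    assume "v \<in> {..<d} \<rightarrow>\<^sub>E (UNIV :: 'a set)"
    then show "restrict (\<lambda>i. if i < d then v i else 0) {..<d} i = v i"
      using PiE_arb[of v "{..<d}" "\<lambda>_. UNIV" i] by (cases "i < d") simp_all
  qed
  show "(\<lambda>v. restrict v {..<d}) ` (coords d :: (nat \<Rightarrow> 'a) set) \<subseteq> {..<d} \<rightarrow>\<^sub>E (UNIV :: 'a set)"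
    by (intro image_subsetI) (simp add: restrict_PiE_iff)
  show "(\<lambda>v i. if i < d then v i else 0) ` ({..<d} \<rightarrow>\<^sub>E (UNIV :: 'a set)) \<subseteq> (coords d :: (nat \<Rightarrow> 'a) set)"
    by (intro image_subsetI) (simp add: coords_def)
qed

lemma finite_coords: "finite (coords d :: (nat \<Rightarrow> 'a::{field,finite}) set)"
  using bij_betw_finite[OF coords_bij[of d, where 'a = 'a]] by (simp add: finite_PiE)

lemma card_coords: "card (coords d :: (nat \<Rightarrow> 'a::{field,finite}) set) = CARD('a) ^ d"
  using bij_betw_same_card[OF coords_bij[of d, where 'a = 'a]] by (simp add: card_PiE)

lemma coords_eqI: "v \<in> coords d \<Longrightarrow> w \<in> coords d \<Longrightarrow> (\<And>i. i < d \<Longrightarrow> v i = w i) \<Longrightarrow> v = w"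
  by (rule ext, rename_tac i, case_tac "i < d") (simp_all add: coords_def)

lemma sform_cunit:
  assumes "i < n"
  shows "sform n x (cunit i) = x (n + i)" "sform n x (cunit (n + i)) = - x i"
  using assms unfolding sform_def cunit_def
  by (simp_all add: if_distrib[of "(*) _"] sum.delta sum_negf cong: if_cong)

lemma symp_space_coords:
  assumes "n \<ge> 2" and "(2::'a::{field,finite}) \<noteq> 0"
  shows "symp_space cscale (coords (2 * n)) (sform n) (cunit (n - 1) :: nat \<Rightarrow> 'a) n"
proof -
  interpret vector_space "cscale :: 'a \<Rightarrow> _" by (rule vector_space_cscale)
  show ?thesis
  proof
    show "subspace (coords (2 * n) :: (nat \<Rightarrow> 'a) set)"
      by (simp add: subspace_def coords_def cscale_apply)
    show "x = 0" if x: "x \<in> coords (2 * n)" "\<And>y. y \<in> coords (2 * n) \<Longrightarrow> sform n x y = 0"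
      for x :: "nat \<Rightarrow> 'a"
    proof (rule coords_eqI[OF x(1)])
      fix i assume "i < 2 * n"
      show "x i = 0 i"
      proof (cases "i < n")
        case True
        have "sform n x (cunit (n + i)) = 0" by (intro x cunit_in_coords) (use True in simp)
        then show ?thesis unfolding sform_cunit(2)[OF True] by simp
      next
        case False
        then obtain k where k: "i = n + k" "k < n" using \<open>i < 2 * n\<close>
          by (metis add_less_cancel_left le_Suc_ex linorder_not_less mult_2)
        have "sform n x (cunit k) = 0" by (intro x cunit_in_coords) (use k in simp)
        then show ?thesis unfolding sform_cunit(1)[OF k(2)] k(1) by simp
      qed
    qed (simp add: coords_def)
    show "(cunit (n - 1) :: nat \<Rightarrow> 'a) \<noteq> 0"
      by (auto simp: cunit_def fun_eq_iff)
    show "sform n x y = - sform n y x" for x y :: "nat \<Rightarrow> 'a"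
      unfolding sform_def sum_negf[symmetric] by (intro sum.cong refl) simp
    show "sform n (x + y) z = sform n x z + sform n y z" for x y z :: "nat \<Rightarrow> 'a"
      by (simp add: sform_def distrib_right sum.distrib sum_subtractf)
    show "sform n (cscale c x) z = c * sform n x z" for c and x z :: "nat \<Rightarrow> 'a"
      by (simp add: cscale_apply sform_def sum_distrib_left right_diff_distrib mult.assoc)
    show "sform n x x = 0" for x :: "nat \<Rightarrow> 'a"
      unfolding sform_def by (intro sum.neutral) simp

    show "finite (coords (2*n) :: (nat \<Rightarrow> 'a) set)" by (rule finite_coords)
    show "card (coords (2*n) :: (nat \<Rightarrow> 'a) set) = CARD('a)^(2*n)" by (rule card_coords)
    show "2 \<le> n" by (rule assms)
    show "(cunit (n-1) :: nat \<Rightarrow> 'a) \<in> coords (2*n)" by (rule cunit_in_coords) (use assms in simp)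
    show "(2::'a) \<noteq> 0" by (rule assms)
  qed
qed

lemma act_add: "act M (v + w) = act M v + act M w"
  by (rule ext) (simp add: act_def distrib_left sum.distrib)

lemma act_cscale: "act M (cscale c v) = cscale c (act M v)"
  by (rule ext) (simp add: cscale_apply act_def sum_distrib_left mult.left_commute)

lemma act_in_coords: "M \<in> carrier_mat d d \<Longrightarrow> act M v \<in> coords d"
  by (auto simp: act_def coords_def)

lemma act_apply:
  "M \<in> carrier_mat d d \<Longrightarrow> act M v i = (if i < d then \<Sum>j<d. M $$ (i, j) * v j else 0)"
  by (simp only: act_def carrier_matD)

lemma act_mult:
  assumes M: "M \<in> carrier_mat d d" "M' \<in> carrier_mat d d"
  shows "act (M * M') v = act M (act M' v)"
proof
  fix i
  show "act (M * M') v i = act M (act M' v) i"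
  proof (cases "i < d")
    case True
    have "act (M * M') v i = (\<Sum>j<d. (M * M') $$ (i, j) * v j)"
      using True M by (simp add: act_apply[of _ d])
    also have "\<dots> = (\<Sum>j<d. \<Sum>k<d. M $$ (i, k) * M' $$ (k, j) * v j)"
      using True M by (intro sum.cong refl)
        (auto simp: scalar_prod_def atLeast0LessThan sum_distrib_right)
    also have "\<dots> = (\<Sum>k<d. \<Sum>j<d. M $$ (i, k) * M' $$ (k, j) * v j)"
      by (rule sum.swap)
    also have "\<dots> = act M (act M' v) i"
      using True M by (simp add: act_apply[of _ d] sum_distrib_left mult.assoc)
    finally show ?thesis .
  qed (use M in \<open>simp add: act_apply[of _ d]\<close>)
qed

lemma act_one:
  assumes "v \<in> coords d"
  shows "act (1\<^sub>m d) v = v"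
proof
  fix i
  show "act (1\<^sub>m d) v i = v i"
  proof (cases "i < d")
    case True
    then have "act (1\<^sub>m d) v i = (\<Sum>j<d. if i = j then v j else 0)"
      unfolding act_apply[OF one_carrier_mat] by (auto intro!: sum.cong simp del: sum.delta sum.delta')
    also have "\<dots> = v i" using True by simp
    finally show ?thesis using True by simp
  qed (use assms in \<open>simp add: act_apply[OF one_carrier_mat] coords_def\<close>)
qed

lemma act_uminus: "act (- M) v = - act M v"
proof
  fix i
  have "(\<Sum>j<dim_col M. (- M) $$ (i, j) * v j) = (\<Sum>j<dim_col M. - (M $$ (i, j) * v j))"
    if "i < dim_row M"
    using that by (intro sum.cong refl) simp
  then show "act (- M) v i = (- act M v) i"
    by (simp add: act_def sum_negf)
qed

lemma act_cunit:
  assumes "M \<in> carrier_mat d d" "i < d" "j < d"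
  shows "act M (cunit j) i = M $$ (i, j)"
  using assms(2,3) by (simp add: act_apply[OF assms(1)] sum_cunit)

lemma act_inject:
  assumes "M \<in> carrier_mat d d" "M' \<in> carrier_mat d d"
    and eq: "\<And>v. v \<in> coords d \<Longrightarrow> act M v = act M' v"
  shows "M = M'"
proof (rule eq_matI)
  fix i j assume "i < dim_row M'" "j < dim_col M'"
  then show "M $$ (i, j) = M' $$ (i, j)"
    using act_cunit[of _ d i j] eq[OF cunit_in_coords, of j] assms(1,2) by (metis carrier_matD)
qed (use assms in auto)

lemma coords_expand:
  assumes "v \<in> coords d"
  shows "v = (\<Sum>j<d. cscale (v j) (cunit j))"
proof (rule coords_eqI[OF assms])
  show "(\<Sum>j<d. cscale (v j) (cunit j)) \<in> coords d"
    by (auto simp: coords_def cscale_apply sum_fun_apply cunit_def intro!: sum.neutral)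
  fix i assume "i < d"
  then show "v i = (\<Sum>j<d. cscale (v j) (cunit j)) i"
    by (simp add: cscale_apply sum_fun_apply sum_cunit)
qed

lemma mat_of_carrier [simp]: "mat_of d f \<in> carrier_mat d d"
  by (simp add: mat_of_def)

lemma act_mat_of:
  assumes add: "\<And>v w. f (v + w) = f v + f w" and scale: "\<And>c v. f (cscale c v) = cscale c (f v)"
    and im: "\<And>v. v \<in> coords d \<Longrightarrow> f v \<in> coords d" and v: "v \<in> coords d"
  shows "act (mat_of d f) v = f v"
proof (rule coords_eqI)
  fix i assume i: "i < d"
  have "cscale 0 w = 0" for w :: "nat \<Rightarrow> 'a" by (simp add: cscale_apply fun_eq_iff)
  then have "f 0 = 0" using scale[of 0 0] by simp
  then have f_sum: "f (\<Sum>j\<in>S. g j) = (\<Sum>j\<in>S. f (g j))" for S and g :: "nat \<Rightarrow> nat \<Rightarrow> 'a"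
    by (induction S rule: infinite_finite_induct) (simp_all add: add)
  have "f v = (\<Sum>j<d. cscale (v j) (f (cunit j)))"
    by (subst coords_expand[OF v]) (simp add: f_sum scale)
  then show "act (mat_of d f) v i = f v i"
    using i by (simp add: cscale_apply act_def mat_of_def sum_fun_apply mult.commute)
qed (use act_in_coords[OF mat_of_carrier] im v in auto)

subsection \<open>The symplectic group\<close>

text \<open>Up to an overall sign, the Gram matrix of the form has \<open>half_sign n i\<close> at
  \<open>(i, swap_half n i)\<close> and 0 elsewhere.\<close>

definition swap_half :: "nat \<Rightarrow> nat \<Rightarrow> nat" where
  "swap_half n i = (if i < n then i + n else i - n)"

definition half_sign :: "nat \<Rightarrow> nat \<Rightarrow> 'a::field" where
  "half_sign n i = (if i < n then 1 else - 1)"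

text \<open>The adjoint of \<open>M\<close> for the form \<open>sform n\<close>, which is the second factor in the definition of \<open>Sp\<close>.\<close>

definition sadj :: "nat \<Rightarrow> 'a::field mat \<Rightarrow> 'a mat" where
  "sadj n M = mat (2 * n) (2 * n)
     (\<lambda>(i, j). half_sign n i * half_sign n j * M $$ (swap_half n j, swap_half n i))"

lemma sadj_carrier [simp]: "sadj n M \<in> carrier_mat (2 * n) (2 * n)"
  by (simp add: sadj_def)

lemma sum_2n_split:
  fixes f :: "nat \<Rightarrow> 'a::comm_monoid_add"
  shows "(\<Sum>i<2 * n. f i) = (\<Sum>i<n. f i) + (\<Sum>i<n. f (n + i))"
proof -
  have "(\<Sum>i<n + m. f i) = (\<Sum>i<n. f i) + (\<Sum>i<m. f (n + i))" for m
    by (induction m) (simp_all add: add.assoc)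
  then show ?thesis by (simp add: mult_2)
qed

lemma sform_alt: "sform n v w = - (\<Sum>i<2 * n. half_sign n i * v i * w (swap_half n i))"
proof -
  have "(\<Sum>i<n. half_sign n i * v i * w (swap_half n i)) = (\<Sum>i<n. v i * w (n + i))"
    by (rule sum.cong) (simp_all add: half_sign_def swap_half_def add.commute)
  moreover have "(\<Sum>i<n. half_sign n (n + i) * v (n + i) * w (swap_half n (n + i)))
      = (\<Sum>i<n. - (v (n + i) * w i))"
    by (rule sum.cong) (simp_all add: half_sign_def swap_half_def)
  ultimately show ?thesis
    by (simp add: sum_2n_split sform_def sum_negf sum_subtractf)
qed

lemma sum_swap_half: "(\<Sum>i<2 * n. f (swap_half n i)) = (\<Sum>i<2 * n. f i)"
  by (rule sum.reindex_bij_witness[of _ "swap_half n" "swap_half n"]) (auto simp: swap_half_def)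

lemma sform_sadj:
  assumes "M \<in> carrier_mat (2 * n) (2 * n)"
  shows "sform n (act M v) w = sform n v (act (sadj n M) w)"
proof -
  have ss: "swap_half n (swap_half n i) = i" "swap_half n i < 2 * n"
    "half_sign n (swap_half n i) = - (half_sign n i :: 'a)" if "i < 2 * n" for i
    using that by (auto simp: swap_half_def half_sign_def)
  have hh: "half_sign n i * (half_sign n i * x) = x" for i and x :: 'a
    by (simp add: half_sign_def)
  have "- sform n (act M v) w
      = (\<Sum>i<2 * n. \<Sum>j<2 * n. half_sign n i * M $$ (i, j) * v j * w (swap_half n i))"
    using assms unfolding sform_alt act_def by (simp add: sum_distrib_left sum_distrib_right mult.assoc)
  also have "\<dots> = (\<Sum>j<2 * n. \<Sum>i<2 * n. half_sign n i * M $$ (i, j) * v j * w (swap_half n i))"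
    by (rule sum.swap)
  also have "\<dots> = (\<Sum>j<2 * n. half_sign n j * v j *
      (\<Sum>i<2 * n. sadj n M $$ (swap_half n j, i) * w i))"
  proof (rule sum.cong[OF refl])
    fix j assume "j \<in> {..<2 * n}"
    then have j: "j < 2 * n" by simp
    have "(\<Sum>i<2 * n. sadj n M $$ (swap_half n j, i) * w i)
        = (\<Sum>i<2 * n. sadj n M $$ (swap_half n j, swap_half n i) * w (swap_half n i))"
      by (rule sum_swap_half[symmetric])
    also have "\<dots> = (\<Sum>i<2 * n. half_sign n j * (half_sign n i * M $$ (i, j) * w (swap_half n i)))"
      using j by (intro sum.cong refl) (simp add: sadj_def ss)
    finally show "(\<Sum>i<2 * n. half_sign n i * M $$ (i, j) * v j * w (swap_half n i))
        = half_sign n j * v j * (\<Sum>i<2 * n. sadj n M $$ (swap_half n j, i) * w i)"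
      by (simp add: sum_distrib_left mult_ac hh)
  qed
  also have "\<dots> = - sform n v (act (sadj n M) w)"
    unfolding sform_alt act_def using sadj_carrier[of n M]
    by (simp add: ss del: sadj_carrier)
  finally show ?thesis by simp
qed

lemma sadj_four_block:
  assumes "X \<in> carrier_mat n n" "A \<in> carrier_mat n n" "B \<in> carrier_mat n n" "Y \<in> carrier_mat n n"
  shows "sadj n (four_block_mat X A B Y)
    = four_block_mat (transpose_mat Y) (- transpose_mat A) (- transpose_mat B) (transpose_mat X)"
  using assms by (intro eq_matI) (auto simp: sadj_def swap_half_def half_sign_def)

lemma carrier_Sp: "carrier (Sp TYPE('a::field) n)
    = {M \<in> carrier_mat (2 * n) (2 * n). M * sadj n M = (1\<^sub>m (2 * n) :: 'a mat)}" (is "_ = ?R")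
proof (intro equalityI subsetI)
  fix M assume "M \<in> carrier (Sp TYPE('a) n)"
  then show "M \<in> ?R" unfolding Sp_def by (auto simp: sadj_four_block mult_2)
next
  fix M assume M: "M \<in> ?R"
  then have dims: "dim_row M = n + n" "dim_col M = n + n" by auto
  obtain X A B Y where s: "split_block M n n = (X, A, B, Y)" by (rule prod_cases4)
  note c = split_block[OF s dims]
  show "M \<in> carrier (Sp TYPE('a) n)"
    unfolding Sp_def using M c sadj_four_block[OF c(1-4)] by auto
qed

lemma Sp_carrier_mat: "M \<in> carrier (Sp TYPE('a::field) n) \<Longrightarrow> M \<in> carrier_mat (2 * n) (2 * n)"
  by (simp add: carrier_Sp)

lemma Sp_simps [simp]: "mult (Sp TYPE('a::field) n) = (*)" "one (Sp TYPE('a) n) = 1\<^sub>m (2 * n)"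
  by (simp_all add: Sp_def)

text \<open>A one-sided inverse of a square matrix is two-sided, so the defining equation says that
  \<open>sadj n M * M\<close> is the identity. By adjointness and nondegeneracy this means that
  \<open>M\<close> preserves the form.\<close>

lemma Sp_iff:
  assumes "n \<ge> 2" "(2::'a::{field,finite}) \<noteq> 0"
  shows "M \<in> carrier (Sp TYPE('a) n) \<longleftrightarrow> M \<in> carrier_mat (2 * n) (2 * n) \<and>
    (\<forall>v\<in>coords (2 * n). \<forall>w\<in>coords (2 * n). sform n (act M v) (act M w) = sform n v w)"
    (is "?l \<longleftrightarrow> ?c \<and> ?r")
proof -
  interpret symp_space cscale "coords (2 * n)" "sform n" "cunit (n - 1) :: nat \<Rightarrow> 'a" n
    by (rule symp_space_coords[OF assms])
  have "M * sadj n M = 1\<^sub>m (2 * n) \<longleftrightarrow> ?r" if c: ?c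
  proof -
    have comm: "M * sadj n M = 1\<^sub>m (2 * n) \<longleftrightarrow> sadj n M * M = 1\<^sub>m (2 * n)"
      using mat_mult_left_right_inverse c sadj_carrier by blast
    have eq: "sform n (act M v) (act M w) = sform n v (act (sadj n M * M) w)" for v w :: "nat \<Rightarrow> 'a"
      using c by (simp add: sform_sadj act_mult[OF sadj_carrier])
    have "sadj n M * M = 1\<^sub>m (2 * n)" if r: ?r
    proof (rule act_inject)
      fix w :: "nat \<Rightarrow> 'a" assume w: "w \<in> coords (2 * n)"
      have m: "sadj n M * M \<in> carrier_mat (2 * n) (2 * n)"
        by (rule mult_carrier_mat[OF sadj_carrier c])
      have "act (sadj n M * M) w - w = 0"
      proof (rule nondeg)
        fix v :: "nat \<Rightarrow> 'a" assume v: "v \<in> coords (2 * n)"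
        have "sform n v (act (sadj n M * M) w - w) = 0" using r v w eq[of v w] by simp
        then show "sform n (act (sadj n M * M) w - w) v = 0"
          using form_anti[of "act (sadj n M * M) w - w" v] by simp
      qed (use w act_in_coords[OF m] in \<open>auto intro: U_closed\<close>)
      then show "act (sadj n M * M) w = act (1\<^sub>m (2 * n)) w" using w by (simp add: act_one)
    qed (auto intro: mult_carrier_mat[OF sadj_carrier c])
    moreover have ?r if "sadj n M * M = 1\<^sub>m (2 * n)"
      using that eq by (simp add: act_one)
    ultimately show ?thesis using comm by blast
  qed
  then have "M \<in> carrier_mat (2 * n) (2 * n) \<and> M * sadj n M = 1\<^sub>m (2 * n)
      \<longleftrightarrow> M \<in> carrier_mat (2 * n) (2 * n) \<and> ?r"
    by (rule conj_cong[OF refl])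
  then show ?thesis unfolding carrier_Sp mem_Collect_eq .
qed

declare One_nat_def [simp del]

section \<open>The action on the standard symplectic space\<close>

locale symp_coords =
  fixes n :: nat and ty :: "'a::{field,finite} itself"
  assumes n_ge_2: "n \<ge> 2" and two_neq_0: "(2::'a) \<noteq> 0"
begin

sublocale symp_space cscale "coords (2 * n)" "sform n" "cunit (n - 1) :: nat \<Rightarrow> 'a" n
  by (rule symp_space_coords[OF n_ge_2 two_neq_0])

abbreviation G where "G \<equiv> Sp TYPE('a) n"
abbreviation V where "V \<equiv> coords (2 * n) :: (nat \<Rightarrow> 'a) set"
abbreviation e where "e \<equiv> cunit (n - 1) :: nat \<Rightarrow> 'a"

lemma Sp_I:
  assumes "M \<in> carrier_mat (2 * n) (2 * n)"
    and "\<And>v w. v \<in> V \<Longrightarrow> w \<in> V \<Longrightarrow> sform n (act M v) (act M w) = sform n v w"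
  shows "M \<in> carrier G"
  using assms Sp_iff[OF n_ge_2 two_neq_0] by blast

lemma Sp_form:
  "M \<in> carrier G \<Longrightarrow> v \<in> V \<Longrightarrow> w \<in> V \<Longrightarrow> sform n (act M v) (act M w) = sform n v w"
  using Sp_iff[OF n_ge_2 two_neq_0] by blast

lemma Sp_act_V: "M \<in> carrier G \<Longrightarrow> act M v \<in> V"
  by (rule act_in_coords[OF Sp_carrier_mat])

lemma Sp_act_mult: "M \<in> carrier G \<Longrightarrow> M' \<in> carrier G \<Longrightarrow> act (M * M') v = act M (act M' v)"
  by (rule act_mult[OF Sp_carrier_mat Sp_carrier_mat])

lemma Sp_inject: "M \<in> carrier G \<Longrightarrow> M' \<in> carrier G \<Longrightarrow> (\<And>v. v \<in> V \<Longrightarrow> act M v = act M' v) \<Longrightarrow> M = M'"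
  by (rule act_inject[OF Sp_carrier_mat Sp_carrier_mat])

lemma group_Sp: "group G"
proof (rule groupI)
  show "x \<otimes>\<^bsub>G\<^esub> y \<in> carrier G" if "x \<in> carrier G" "y \<in> carrier G" for x y
    using that Sp_carrier_mat[of x n] Sp_carrier_mat[of y n]
    by (intro Sp_I) (auto simp: Sp_act_mult Sp_form Sp_act_V)
  show "\<one>\<^bsub>G\<^esub> \<in> carrier G"
    by (intro Sp_I) (simp_all add: act_one)
  show "x \<otimes>\<^bsub>G\<^esub> y \<otimes>\<^bsub>G\<^esub> z = x \<otimes>\<^bsub>G\<^esub> (y \<otimes>\<^bsub>G\<^esub> z)"
    if "x \<in> carrier G" "y \<in> carrier G" "z \<in> carrier G" for x y z
    using that[THEN Sp_carrier_mat] by (simp add: assoc_mult_mat)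
  show "\<one>\<^bsub>G\<^esub> \<otimes>\<^bsub>G\<^esub> x = x" if "x \<in> carrier G" for x
    using Sp_carrier_mat[OF that] by simp
  show "\<exists>y\<in>carrier G. y \<otimes>\<^bsub>G\<^esub> x = \<one>\<^bsub>G\<^esub>" if x: "x \<in> carrier G" for x
  proof
    have xs: "x * sadj n x = 1\<^sub>m (2 * n)" using x by (simp add: carrier_Sp)
    then show "sadj n x \<otimes>\<^bsub>G\<^esub> x = \<one>\<^bsub>G\<^esub>"
      using mat_mult_left_right_inverse[OF Sp_carrier_mat[OF x] sadj_carrier] by simp
    have inv: "act x (act (sadj n x) v) = v" if "v \<in> V" for v
      using that act_mult[OF Sp_carrier_mat[OF x] sadj_carrier[of n x], of v] xs by (simp add: act_one)
    show "sadj n x \<in> carrier G"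
    proof (rule Sp_I)
      fix v w assume vw: "v \<in> V" "w \<in> V"
      note sV = act_in_coords[OF sadj_carrier[of n x]]
      show "sform n (act (sadj n x) v) (act (sadj n x) w) = sform n v w"
        using Sp_form[OF x sV sV, of v w] inv vw by simp
    qed simp
  qed
qed

sublocale Sp: group G by (rule group_Sp)

lemma finite_Sp: "finite (carrier G)"
proof -
  let ?f = "\<lambda>M :: 'a mat. \<lambda>i\<in>{..<2 * n}. \<lambda>j\<in>{..<2 * n}. M $$ (i, j)"
  have "inj_on ?f (carrier G)"
  proof (rule inj_onI)
    fix M M' assume M: "M \<in> carrier G" "M' \<in> carrier G" and eq: "?f M = ?f M'"
    show "M = M'"
    proof (rule eq_matI)
      fix i j assume ij: "i < dim_row M'" "j < dim_col M'"
      then have "i < 2 * n" "j < 2 * n" using Sp_carrier_mat[OF M(2)] by auto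
      then show "M $$ (i, j) = M' $$ (i, j)"
        using fun_cong[OF fun_cong[OF eq, of i], of j] by simp
    qed (use Sp_carrier_mat[OF M(1)] Sp_carrier_mat[OF M(2)] in auto)
  qed
  moreover have "?f ` carrier G \<subseteq> {..<2 * n} \<rightarrow>\<^sub>E ({..<2 * n} \<rightarrow>\<^sub>E UNIV)"
    by (simp add: image_subset_iff restrict_PiE_iff)
  then have "finite (?f ` carrier G)"
    by (rule finite_subset) (intro finite_PiE finite_lessThan finite)
  ultimately show ?thesis using finite_imageD by blast
qed

lemma act_pow: "M \<in> carrier G \<Longrightarrow> v \<in> V \<Longrightarrow> act (M [^]\<^bsub>G\<^esub> k) v = (act M ^^ k) v" for k :: nat
proof (induction k arbitrary: v)
  case (Suc k)
  have "act (M [^]\<^bsub>G\<^esub> Suc k) v = act (M [^]\<^bsub>G\<^esub> k) (act M v)"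
    using Suc.prems Sp_act_mult[OF Sp.nat_pow_closed] by simp
  then show ?case using Suc Sp_act_V by (simp add: funpow_swap1)
qed (simp add: act_one)

section \<open>Matrices of transvections\<close>

definition tmat where "tmat x c = mat_of (2 * n) (transv x c)"

lemma act_tmat: "x \<in> V \<Longrightarrow> v \<in> V \<Longrightarrow> act (tmat x c) v = transv x c v"
  unfolding tmat_def by (intro act_mat_of transv_add transv_scale transv_U)

lemma tmat_Sp: "x \<in> V \<Longrightarrow> tmat x c \<in> carrier G"
  by (rule Sp_I) (simp_all add: act_tmat transv_form, simp add: tmat_def)

lemma e_V: "e \<in> V" by (rule l_U)

lemma sform_e: "sform n v e = v (2 * n - 1)"
proof -
  have "sform n v e = v (n + (n - 1))"
    by (rule sform_cunit(1)) (use n_ge_2 in simp)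
  moreover have "n + (n - 1) = 2 * n - 1" using n_ge_2 by simp
  ultimately show ?thesis by (simp only:)
qed

text \<open>The even exponent makes the corner entry 1, and by \<open>sform_e\<close> the
  transvection along \<open>e\<close> adds coordinate \<open>2 * n - 1\<close> to coordinate
  \<open>n - 1\<close>.\<close>

lemma g_mat_eq:
  assumes "even (j * (p - 1) div 2)"
  shows "g_mat p j n = tmat e 1"
proof (rule eq_matI)
  fix r c assume "r < dim_row (tmat e 1)" "c < dim_col (tmat e 1)"
  then have rc: "r < 2 * n" "c < 2 * n" by (simp_all add: tmat_def mat_of_def)
  then have "tmat e 1 $$ (r, c) = cunit c r + cunit c (2 * n - 1) * cunit (n - 1) r"
    by (simp add: tmat_def mat_of_def transv_def sform_e cscale_apply del: One_nat_def)
  then show "g_mat p j n $$ (r, c) = tmat e 1 $$ (r, c)"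
    using rc assms n_ge_2 by (auto simp: g_mat_def E_last_def cunit_def)
qed (use n_ge_2 in \<open>auto simp: g_mat_def E_last_def tmat_def mat_of_def\<close>)

abbreviation g where "g \<equiv> tmat e 1"

lemma act_g_pow:
  fixes k :: nat
  assumes v: "v \<in> V"
  shows "act (g [^]\<^bsub>G\<^esub> k) v = transv e (of_nat k) v"
proof -
  have "(act g ^^ k) v = transv e (of_nat k) v"
  proof (induction k)
    case (Suc k)
    then have "(act g ^^ Suc k) v = transv e 1 (transv e (of_nat k) v)"
      using transv_U[OF e_V v] by (simp add: act_tmat e_V)
    also have "\<dots> = transv e (of_nat (Suc k)) v"
      by (simp add: transv_def scale_left_distrib algebra_simps)
    finally show ?case .
  qed (simp add: transv_def)
  then show ?thesis using act_pow[OF tmat_Sp[OF e_V] v] by simp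
qed

end

lemma (in group) conj_pow:
  assumes "t \<in> carrier G" "a \<in> carrier G"
  shows "(t \<otimes> a \<otimes> inv t) [^] (m::nat) = t \<otimes> a [^] m \<otimes> inv t"
proof (induction m)
  case (Suc m)
  have "(t \<otimes> a \<otimes> inv t) [^] Suc m = t \<otimes> a [^] m \<otimes> inv t \<otimes> (t \<otimes> a \<otimes> inv t)"
    using Suc by simp
  also have "\<dots> = t \<otimes> a [^] m \<otimes> (inv t \<otimes> t) \<otimes> a \<otimes> inv t"
    using assms by (simp only: m_assoc m_closed inv_closed nat_pow_closed)
  finally show ?case using assms by (simp add: m_assoc)
qed (use assms in simp)

lemma (in group) conj_bij_roots:
  assumes t: "t \<in> carrier G" and h: "h \<in> carrier G" and comm: "t \<otimes> h = h \<otimes> t"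
  shows "bij_betw (\<lambda>a. t \<otimes> a \<otimes> inv t) {a \<in> carrier G. a [^] (m::nat) = h} {a \<in> carrier G. a [^] m = h}"
proof (rule bij_betw_byWitness[where f' = "\<lambda>a. inv t \<otimes> a \<otimes> t"])
  have c1: "t \<otimes> h \<otimes> inv t = h" using t h comm by (simp add: m_assoc)
  have "inv t \<otimes> h \<otimes> t = inv t \<otimes> (t \<otimes> h)" using t h comm by (simp add: m_assoc)
  also have "\<dots> = h" using t h by (simp add: m_assoc[symmetric])
  finally have c2: "inv t \<otimes> h \<otimes> t = h" .
  show "(\<lambda>a. t \<otimes> a \<otimes> inv t) ` {a \<in> carrier G. a [^] m = h} \<subseteq> {a \<in> carrier G. a [^] m = h}"
    using t c1 by (auto simp: conj_pow)
  show "(\<lambda>a. inv t \<otimes> a \<otimes> t) ` {a \<in> carrier G. a [^] m = h} \<subseteq> {a \<in> carrier G. a [^] m = h}"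
    using t c2 conj_pow[of "inv t"] by auto
  have i1: "inv t \<otimes> (t \<otimes> a \<otimes> inv t) \<otimes> t = a" if "a \<in> carrier G" for a
  proof -
    have "inv t \<otimes> (t \<otimes> a \<otimes> inv t) \<otimes> t = (inv t \<otimes> t) \<otimes> a \<otimes> (inv t \<otimes> t)"
      using that t by (simp only: m_assoc m_closed inv_closed)
    then show ?thesis using that t by simp
  qed
  have i2: "t \<otimes> (inv t \<otimes> a \<otimes> t) \<otimes> inv t = a" if "a \<in> carrier G" for a
  proof -
    have "t \<otimes> (inv t \<otimes> a \<otimes> t) \<otimes> inv t = (t \<otimes> inv t) \<otimes> a \<otimes> (t \<otimes> inv t)"
      using that t by (simp only: m_assoc m_closed inv_closed)
    then show ?thesis using that t by simp
  qed
  show "\<forall>a\<in>{a \<in> carrier G. a [^] m = h}. inv t \<otimes> (t \<otimes> a \<otimes> inv t) \<otimes> t = a"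
    using i1 by blast
  show "\<forall>a\<in>{a \<in> carrier G. a [^] m = h}. t \<otimes> (inv t \<otimes> a \<otimes> t) \<otimes> inv t = a"
    using i2 by blast
qed

context symp_coords
begin

lemma tmat_mult_inverse: "x \<in> V \<Longrightarrow> tmat x (- c) * tmat x c = 1\<^sub>m (2 * n)"
  using Sp.one_closed Sp.m_closed[OF tmat_Sp tmat_Sp, of x x "- c" c]
  by (intro Sp_inject) (simp_all add: Sp_act_mult tmat_Sp act_tmat transv_U act_one)

lemma inv_tmat: "x \<in> V \<Longrightarrow> inv\<^bsub>G\<^esub> (tmat x c) = tmat x (- c)"
  by (rule Sp.inv_equality) (simp_all add: tmat_Sp tmat_mult_inverse)

text \<open>The mixed terms of the two products carry a pairing of \<open>x\<close> with
  \<open>e\<close>, which vanishes for \<open>x\<close> in \<open>L\<close>.\<close>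

lemma tmat_g_commute:
  fixes k :: nat
  assumes x: "x \<in> L"
  shows "tmat x c * g [^]\<^bsub>G\<^esub> k = g [^]\<^bsub>G\<^esub> k * tmat x c"
proof (rule Sp_inject)
  have gk: "g [^]\<^bsub>G\<^esub> k \<in> carrier G" and t: "tmat x c \<in> carrier G"
    using Sp.nat_pow_closed[OF tmat_Sp[OF e_V]] tmat_Sp[OF L_U[OF x]] by auto
  show "tmat x c * g [^]\<^bsub>G\<^esub> k \<in> carrier G" "g [^]\<^bsub>G\<^esub> k * tmat x c \<in> carrier G"
    using Sp.m_closed[OF gk t] Sp.m_closed[OF t gk] by simp_all
  fix v assume v: "v \<in> V"
  have "transv x c (transv e (of_nat k) v) = transv e (of_nat k) (transv x c v)"
    using L_l[OF x] l_L[OF x] unfolding transv_def by (simp add: algebra_simps)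
  then show "act (tmat x c * g [^]\<^bsub>G\<^esub> k) v = act (g [^]\<^bsub>G\<^esub> k * tmat x c) v"
    using v gk t x by (simp add: Sp_act_mult act_g_pow act_tmat transv_U L_U e_V)
qed

section \<open>Roots of the powers of \<open>g\<close>\<close>

definition roots :: "nat \<Rightarrow> 'a mat set" where
  "roots k = {a \<in> carrier G. a [^]\<^bsub>G\<^esub> (2 * n - 1) = g [^]\<^bsub>G\<^esub> k}"

lemma roots_conj:
  assumes x: "x \<in> L"
  shows "\<exists>\<rho>. bij_betw \<rho> (roots k) (roots k) \<and>
      (\<forall>a\<in>roots k. \<forall>v\<in>V. act (\<rho> a) v = transv x c (act a (transv x (- c) v)))"
proof (intro exI conjI ballI)
  have t: "tmat x c \<in> carrier G" and xV: "x \<in> V" using tmat_Sp L_U x by auto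
  have gk: "g [^]\<^bsub>G\<^esub> k \<in> carrier G"
    using Sp.nat_pow_closed[OF tmat_Sp[OF e_V]] by auto
  show "bij_betw (\<lambda>a. tmat x c \<otimes>\<^bsub>G\<^esub> a \<otimes>\<^bsub>G\<^esub> inv\<^bsub>G\<^esub> (tmat x c)) (roots k) (roots k)"
    unfolding roots_def by (rule Sp.conj_bij_roots[OF t gk]) (simp add: tmat_g_commute x)
  fix a v assume a: "a \<in> roots k" and v: "v \<in> V"
  then have aG: "a \<in> carrier G" by (simp add: roots_def)
  have ta: "tmat x c * a \<in> carrier G" using Sp.m_closed[OF t aG] by simp
  show "act (tmat x c \<otimes>\<^bsub>G\<^esub> a \<otimes>\<^bsub>G\<^esub> inv\<^bsub>G\<^esub> (tmat x c)) v = transv x c (act a (transv x (- c) v))"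
    using v xV t aG ta by (simp add: inv_tmat Sp_act_mult tmat_Sp act_tmat Sp_act_V)
qed

text \<open>As \<open>2 * n - 1\<close> is a power of the characteristic, raising
  \<open>act a\<close> to it gives 1 plus the same power of \<open>act a - 1\<close>. By
  \<open>act_g_pow\<close> the result is also the transvection along \<open>e\<close> with
  coefficient \<open>k\<close>.\<close>

lemma roots_symp_root:
  assumes p: "prime p" "CHAR('a) = p" "2 * n - 1 = p ^ j" and k: "of_nat k \<noteq> (0::'a)"
    and a: "a \<in> roots k"
  shows "symp_root cscale V (sform n) e n (act a) (of_nat k)"
proof unfold_locales
  have aG: "a \<in> carrier G" and ak: "a [^]\<^bsub>G\<^esub> (2 * n - 1) = g [^]\<^bsub>G\<^esub> k"
    using a by (auto simp: roots_def)
  show "act a x \<in> V" for x by (rule Sp_act_V[OF aG])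
  show "sform n (act a x) (act a y) = sform n x y" if "x \<in> V" "y \<in> V" for x y
    by (rule Sp_form[OF aG that])
  show "((\<lambda>v. act a v - v) ^^ (2 * n - 1)) x = cscale (of_nat k * sform n x e) e" if x: "x \<in> V" for x
  proof -
    have "x + ((\<lambda>v. act a v - v) ^^ (2 * n - 1)) x = (act a ^^ (2 * n - 1)) x"
      unfolding p(3) by (rule funpow_CHAR_power[OF p(1,2) act_add act_cscale, symmetric])
    also have "\<dots> = transv e (of_nat k) x"
      by (simp only: act_pow[OF aG x, symmetric] ak act_g_pow[OF x])
    finally show ?thesis unfolding transv_def by (rule add_left_imp_eq)
  qed
qed (use k in \<open>simp_all add: act_add act_cscale\<close>)

lemma symp_roots_roots:
  assumes "prime p" "CHAR('a) = p" "2 * n - 1 = p ^ j" "of_nat k \<noteq> (0::'a)"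
    and "quadratic_char (\<chi> :: 'a \<Rightarrow> int)"
  shows "symp_roots cscale V (sform n) e n \<chi> (roots k) act (of_nat k)"
proof (intro symp_roots.intro symp_roots_axioms.intro symp_space_axioms assms(5))
  show "finite (roots k)" using finite_Sp by (simp add: roots_def)
qed (use roots_conj roots_symp_root[OF assms(1-4)] in auto)

section \<open>From counts of roots to character sums\<close>

definition \<phi> where "\<phi> \<chi> u = (\<Sum>v\<in>L - Fl. (\<chi> (sform n v (act u v)) :: int))"

text \<open>\<open>FSZ_set\<close> consists of the roots \<open>a\<close> for which
  \<open>a * u\<close> is a root. Substituting \<open>b = a * u\<close> gives a sum over pairs of
  roots, and \<open>\<phi> \<chi> u\<close> can be read off the pair since \<open>a\<close> is an
  isometry.\<close>

lemma sum_phi_FSZ: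
  "(\<Sum>u\<in>carrier G. \<phi> \<chi> u * int (card (FSZ_set G (2 * n - 1) u (g [^]\<^bsub>G\<^esub> k))))
    = (\<Sum>a\<in>roots k. \<Sum>b\<in>roots k. \<Sum>v\<in>L - Fl. \<chi> (sform n (act a v) (act b v)))"
proof -
  let ?R = "roots k"
  define \<Psi> where "\<Psi> a b = (\<Sum>v\<in>L - Fl. \<chi> (sform n (act a v) (act b v)))" for a b
  have finR: "finite ?R" using finite_Sp by (simp add: roots_def)
  have FSZ: "FSZ_set G (2 * n - 1) u (g [^]\<^bsub>G\<^esub> k) = {a \<in> ?R. a * u \<in> ?R}" if "u \<in> carrier G" for u
    using that Sp.m_closed[of _ u] by (auto simp: FSZ_set_def roots_def)
  have \<phi>: "\<phi> \<chi> u = \<Psi> a (a * u)" if "u \<in> carrier G" "a \<in> ?R" for u a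
    unfolding \<phi>_def \<Psi>_def using that L_U
    by (intro sum.cong refl) (auto simp: roots_def Sp_act_mult Sp_form Sp_act_V)
  have "(\<Sum>u\<in>carrier G. \<phi> \<chi> u * int (card (FSZ_set G (2 * n - 1) u (g [^]\<^bsub>G\<^esub> k))))
      = (\<Sum>u\<in>carrier G. \<Sum>a\<in>{a \<in> ?R. a * u \<in> ?R}. \<phi> \<chi> u)"
    by (intro sum.cong refl) (simp add: FSZ)
  also have "\<dots> = (\<Sum>u\<in>carrier G. \<Sum>a\<in>?R. if a * u \<in> ?R then \<Psi> a (a * u) else 0)"
  proof (rule sum.cong[OF refl])
    fix u assume u: "u \<in> carrier G"
    have "(\<Sum>a\<in>{a \<in> ?R. a * u \<in> ?R}. \<phi> \<chi> u) = (\<Sum>a\<in>?R. if a * u \<in> ?R then \<phi> \<chi> u else 0)"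
      by (rule sum.inter_filter[OF finR])
    also have "\<dots> = (\<Sum>a\<in>?R. if a * u \<in> ?R then \<Psi> a (a * u) else 0)"
      by (rule sum.cong[OF refl]) (simp add: \<phi>[OF u, symmetric])
    finally show "(\<Sum>a\<in>{a \<in> ?R. a * u \<in> ?R}. \<phi> \<chi> u)
        = (\<Sum>a\<in>?R. if a * u \<in> ?R then \<Psi> a (a * u) else 0)" .
  qed
  also have "\<dots> = (\<Sum>a\<in>?R. \<Sum>u\<in>carrier G. if a * u \<in> ?R then \<Psi> a (a * u) else 0)"
    by (rule sum.swap)
  also have "\<dots> = (\<Sum>a\<in>?R. \<Sum>b\<in>?R. \<Psi> a b)"
  proof (rule sum.cong[OF refl])
    fix a assume "a \<in> ?R"
    then have a: "a \<in> carrier G" by (simp add: roots_def)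
    have "(\<Sum>u\<in>carrier G. if a * u \<in> ?R then \<Psi> a (a * u) else 0)
        = (\<Sum>b\<in>carrier G. if b \<in> ?R then \<Psi> a b else 0)"
      using a Sp.inv_closed[OF a] Sp.m_closed[OF a] Sp.m_closed[OF Sp.inv_closed[OF a]]
        Sp.inv_solve_left[OF a] Sp.m_assoc[symmetric, OF a Sp.inv_closed[OF a]]
        Sp.m_assoc[symmetric, OF Sp.inv_closed[OF a] a] Sp.r_inv[OF a] Sp.l_inv[OF a] Sp.l_one
      by (intro sum.reindex_bij_witness[of _ "\<lambda>b. inv\<^bsub>G\<^esub> a * b" "\<lambda>u. a * u"]) simp_all
    also have "\<dots> = (\<Sum>b\<in>?R. \<Psi> a b)"
      using finite_Sp by (simp add: sum.inter_filter[symmetric] roots_def)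
    finally show "(\<Sum>u\<in>carrier G. if a * u \<in> ?R then \<Psi> a (a * u) else 0) = (\<Sum>b\<in>?R. \<Psi> a b)" .
  qed
  finally show ?thesis unfolding \<Psi>_def .
qed

definition neg where "neg = (- 1\<^sub>m (2 * n) :: 'a mat)"

lemma act_neg: "v \<in> V \<Longrightarrow> act neg v = - v"
  unfolding neg_def by (simp add: act_uminus act_one)

lemma neg_Sp: "neg \<in> carrier G"
  by (rule Sp_I) (simp_all add: act_neg, simp add: neg_def)

lemma neg_mult: "M \<in> carrier G \<Longrightarrow> neg * M = - M" "M \<in> carrier G \<Longrightarrow> M * neg = - M"
  unfolding neg_def using Sp_carrier_mat[of M n] by auto

lemma phi_neg:
  assumes "quadratic_char \<chi>" "u \<in> carrier G"
  shows "\<phi> \<chi> (- u) = \<phi> \<chi> u"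
proof -
  interpret quadratic_char \<chi> by fact
  show ?thesis unfolding \<phi>_def by (simp add: act_uminus)
qed

text \<open>If all the symmetrised counts agreed, weighting them by \<phi> and summing would give
  equal double sums for the exponents 1 and \<open>k\<close>. By \<open>chi_A_pos\<close> the first
  is positive and the second is not.\<close>

lemma ex_asymmetric:
  assumes p: "prime p" "CHAR('a) = p" "2 * n - 1 = p ^ j"
    and \<chi>: "quadratic_char (\<chi> :: 'a \<Rightarrow> int)" and k: "\<chi> (of_nat k) = - 1"
    and nonempty: "roots 1 \<noteq> {}"
  defines "f \<equiv> \<lambda>k u. card (FSZ_set G (2 * n - 1) u (g [^]\<^bsub>G\<^esub> k))"
  shows "\<exists>u\<in>carrier G. f 1 u + f 1 (- u) \<noteq> f k u + f k (- u)"
proof (rule ccontr)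
  interpret \<chi>: quadratic_char \<chi> by fact
  assume neg: "\<not> ?thesis"
  have k0: "of_nat k \<noteq> (0::'a)" using k by auto
  interpret R1: symp_roots cscale V "sform n" e n \<chi> "roots 1" act "of_nat 1"
    by (rule symp_roots_roots[OF p _ \<chi>]) simp
  interpret Rk: symp_roots cscale V "sform n" e n \<chi> "roots k" act "of_nat k"
    by (rule symp_roots_roots[OF p k0 \<chi>])
  have A1: "R1.A > 0" using R1.chi_A_pos[OF nonempty] by simp
  \<comment> \<open>No root for the exponent \<open>k\<close> has been exhibited. An empty set of
    roots gives the value 0, which still suffices.\<close>
  have Ak: "Rk.A \<le> 0"
  proof (cases "roots k = {}")
    case True
    show ?thesis unfolding Rk.A_def unfolding True by simp
  next
    case False
    then show ?thesis using Rk.chi_A_pos k by simp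
  qed
  have uminus_Sp: "- u \<in> carrier G" if "u \<in> carrier G" for u
    using Sp.m_closed[OF neg_Sp that] neg_mult[OF that] by simp
  \<comment> \<open>\<phi> is even in \<open>u\<close>, so the counts at \<open>u\<close> and at
    \<open>- u\<close> have the same weighted sum.\<close>
  have sum: "(\<Sum>u\<in>carrier G. \<phi> \<chi> u * int (f i u)) = (\<Sum>u\<in>carrier G. \<phi> \<chi> u * int (f i (- u)))" for i
    by (rule sum.reindex_bij_witness[of _ "\<lambda>u. - u" "\<lambda>u. - u"])
      (use phi_neg[OF \<chi>] uminus_Sp in auto)
  have sum2: "2 * (\<Sum>u\<in>carrier G. \<phi> \<chi> u * int (f i u))
      = (\<Sum>u\<in>carrier G. \<phi> \<chi> u * int (f i u + f i (- u)))" for i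
    using sum[of i] by (simp add: distrib_left sum.distrib)
  have "(\<Sum>u\<in>carrier G. \<phi> \<chi> u * int (f 1 u + f 1 (- u)))
      = (\<Sum>u\<in>carrier G. \<phi> \<chi> u * int (f k u + f k (- u)))"
  proof (rule sum.cong[OF refl])
    fix u assume "u \<in> carrier G"
    then have "f 1 u + f 1 (- u) = f k u + f k (- u)" using neg by blast
    then show "\<phi> \<chi> u * int (f 1 u + f 1 (- u)) = \<phi> \<chi> u * int (f k u + f k (- u))" by simp
  qed
  then have "(\<Sum>u\<in>carrier G. \<phi> \<chi> u * int (f 1 u)) = (\<Sum>u\<in>carrier G. \<phi> \<chi> u * int (f k u))"
    using sum2[of 1] sum2[of k] by linarith
  then have "R1.A = Rk.A"
    unfolding f_def sum_phi_FSZ R1.A_def Rk.A_def R1.D_def Rk.D_def .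
  then show False using A1 Ak by simp
qed

end

section \<open>Existence of a root of \<open>g\<close>\<close>

context symp_coords
begin

text \<open>The root is the Cayley transform \<open>(1 + X) (1 - X)\<^sup>-\<^sup>1\<close> of a nilpotent element \<open>X\<close> of the symplectic
  Lie algebra.\<close>

lemma cayley_root:
  assumes p: "prime p" "CHAR('a) = p" "2 * n - 1 = p ^ j"
    and X_add: "\<And>v w. X (v + w) = X v + X w" and X_scale: "\<And>c v. X (cscale c v) = cscale c (X v)"
    and X_V: "\<And>v. v \<in> V \<Longrightarrow> X v \<in> V"
    and X_skew: "\<And>v w. sform n (X v) w = - sform n v (X w)"
    and X_top: "\<And>v. v \<in> V \<Longrightarrow> (X ^^ (2 * n)) v = 0"
    and X_root: "\<And>v. v \<in> V \<Longrightarrow> cscale (2 ^ (2 * n - 1)) ((X ^^ (2 * n - 1)) v) = cscale (sform n v e) e"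
  shows "roots 1 \<noteq> {}"
proof -
  have Xpow: "(X ^^ i) (v + w) = (X ^^ i) v + (X ^^ i) w" "(X ^^ i) (cscale c v) = cscale c ((X ^^ i) v)"
    "v \<in> V \<Longrightarrow> (X ^^ i) v \<in> V" for i v w c
    by (induction i) (simp_all add: X_add X_scale X_V)
  \<comment> \<open>The geometric series inverts \<open>1 - X\<close>, because
    \<open>X ^^ (2 * n)\<close> vanishes on \<open>V\<close>.\<close>
  define Y where "Y v = (\<Sum>i<2 * n. (X ^^ i) v)" for v
  have Y_add: "Y (v + w) = Y v + Y w" and Y_scale: "Y (cscale c v) = cscale c (Y v)" for v w c
    by (simp_all add: Y_def Xpow sum.distrib scale_sum_right)
  have Y_V: "Y v \<in> V" if "v \<in> V" for v
    unfolding Y_def by (rule subspace_sum[OF U_sub]) (rule Xpow that)+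
  have X_0: "X 0 = 0" using X_scale[of 0 0] by simp
  have "additive X" by (rule additive.intro) (rule X_add)
  then have X_sum: "X (\<Sum>i\<in>S. f i) = (\<Sum>i\<in>S. X (f i))" for S and f :: "nat \<Rightarrow> nat \<Rightarrow> 'a"
    by (rule additive.sum)
  have Y_eq: "Y v = v + X (Y v)" if v: "v \<in> V" for v
  proof -
    have "Y v + (X ^^ (2 * n)) v = (\<Sum>i<Suc (2 * n). (X ^^ i) v)"
      unfolding Y_def by simp
    also have "\<dots> = v + X (Y v)"
      unfolding Y_def X_sum by (subst sum.lessThan_Suc_shift) simp
    finally show ?thesis using X_top[OF v] by simp
  qed
  define B where "B v = Y v + X (Y v)" for v
  have B_add: "B (v + w) = B v + B w" and B_scale: "B (cscale c v) = cscale c (B v)" for v w c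
    by (simp_all add: B_def X_add X_scale Y_add Y_scale scale_right_distrib)
  have B_V: "B v \<in> V" if "v \<in> V" for v
    unfolding B_def using that by (intro U_closed X_V Y_V)
  have B_form: "sform n (B v) (B w) = sform n v w" if "v \<in> V" "w \<in> V" for v w
  proof -
    \<comment> \<open>The two forms are those of \<open>1 - X\<close> and \<open>1 + X\<close>
      applied to \<open>Y v\<close> and \<open>Y w\<close>; in both, the cross terms cancel by
      skewness.\<close>
    have "v = Y v - X (Y v)" "w = Y w - X (Y w)"
      using Y_eq[OF that(1)] Y_eq[OF that(2)] by (simp_all add: eq_diff_eq)
    then have "sform n v w = sform n (Y v - X (Y v)) (Y w - X (Y w))" by simp
    then show ?thesis unfolding B_def using X_skew[of "Y v" "Y w"] by simp
  qed
  define a where "a = mat_of (2 * n) B"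
  have act_a: "act a v = B v" if "v \<in> V" for v
    unfolding a_def by (rule act_mat_of[OF B_add B_scale B_V that])
  have a: "a \<in> carrier G"
    by (rule Sp_I) (simp_all add: act_a B_form, simp add: a_def)
  have act_a_diff: "act a v - v = cscale 2 (X (Y v))" if "v \<in> V" for v
  proof -
    have "act a v - v = X (Y v) + X (Y v)"
      using act_a[OF that] Y_eq[OF that] by (simp add: B_def algebra_simps)
    also have "\<dots> = cscale 2 (X (Y v))"
      using scale_left_distrib[of 1 1 "X (Y v)"] by simp
    finally show ?thesis .
  qed
  have XY: "X (Y v) = Y (X v)" for v
    unfolding Y_def X_sum by (simp add: funpow_swap1)
  have Xpow_Y: "(X ^^ i) (Y v) = Y ((X ^^ i) v)" for i v
    by (induction i) (simp_all add: XY)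
  have Ypow_V: "(Y ^^ i) v \<in> V" if "v \<in> V" for i v
    using that by (induction i) (simp_all add: Y_V)
  have N_pow: "((\<lambda>v. act a v - v) ^^ i) v = cscale (2 ^ i) ((X ^^ i) ((Y ^^ i) v))" if v: "v \<in> V" for i v
  proof (induction i)
    case (Suc i)
    let ?w = "cscale (2 ^ i) ((X ^^ i) ((Y ^^ i) v))"
    have "?w \<in> V" using v by (intro U_closed Xpow Ypow_V)
    then have "((\<lambda>v. act a v - v) ^^ Suc i) v = cscale 2 (X (Y ?w))"
      unfolding funpow.simps comp_apply Suc by (rule act_a_diff)
    also have "\<dots> = cscale (2 ^ Suc i) ((X ^^ Suc i) ((Y ^^ Suc i) v))"
      by (simp add: X_scale Y_scale Xpow_Y)
    finally show ?case .
  qed simp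
  \<comment> \<open>\<open>Y\<close> is 1 plus a multiple of \<open>X\<close>, so it disappears
    under the power \<open>2 * n - 1\<close> of \<open>X\<close>. Hence the top power of
    \<open>act a - 1\<close> is \<open>2 ^ (2 * n - 1)\<close> times that of \<open>X\<close>, the
    factor in \<open>X_root\<close>.\<close>
  have X_Y: "(X ^^ (2 * n - 1)) (Y v) = (X ^^ (2 * n - 1)) v" if v: "v \<in> V" for v
  proof -
    have n: "Suc (2 * n - 1) = 2 * n" using n_ge_2 by simp
    have "(X ^^ (2 * n - 1)) (Y v) = (X ^^ (2 * n - 1)) v + (X ^^ (2 * n - 1)) (X (Y v))"
      by (subst Y_eq[OF v]) (simp only: Xpow)
    also have "(X ^^ (2 * n - 1)) (X (Y v)) = (X ^^ Suc (2 * n - 1)) (Y v)"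
      by (simp add: funpow_swap1)
    finally show ?thesis using X_top[OF Y_V[OF v]] by (simp add: n)
  qed
  have X_Ypow: "(X ^^ (2 * n - 1)) ((Y ^^ i) v) = (X ^^ (2 * n - 1)) v" if v: "v \<in> V" for v i
    by (induction i) (simp_all add: X_Y Ypow_V v)
  have "a [^]\<^bsub>G\<^esub> (2 * n - 1) = g"
  proof (rule Sp_inject[OF Sp.nat_pow_closed[OF a] tmat_Sp[OF e_V]])
    fix v assume v: "v \<in> V"
    have "act (a [^]\<^bsub>G\<^esub> (2 * n - 1)) v = (act a ^^ (2 * n - 1)) v" by (rule act_pow[OF a v])
    also have "\<dots> = v + ((\<lambda>v. act a v - v) ^^ (2 * n - 1)) v"
      unfolding p(3) by (rule funpow_CHAR_power[OF p(1,2) act_add act_cscale])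
    also have "\<dots> = act g v"
      using v X_root by (simp add: N_pow X_Ypow act_tmat e_V transv_def)
    finally show "act (a [^]\<^bsub>G\<^esub> (2 * n - 1)) v = act g v" .
  qed
  then have "a \<in> roots 1" using a tmat_Sp[OF e_V] by (simp add: roots_def)
  then show ?thesis by blast
qed

text \<open>The element \<open>X\<close> moves the coordinate \<open>chain k\<close> to \<open>chain (k + 1)\<close> with factor \<open>weight s k\<close>. The chain
  runs through \<open>2n - 1, \<dots>, n, 0, \<dots>, n - 1\<close>.\<close>

definition wshift :: "'a \<Rightarrow> (nat \<Rightarrow> 'a) \<Rightarrow> nat \<Rightarrow> 'a" where
  "wshift s v = (\<lambda>i. if i = 0 then s * v n else if i < n then v (i - 1)
     else if i < 2 * n - 1 then - v (i + 1) else 0)"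

definition chain :: "nat \<Rightarrow> nat" where
  "chain k = (if k < n then 2 * n - 1 - k else k - n)"

definition weight :: "'a \<Rightarrow> nat \<Rightarrow> 'a" where
  "weight s k = (if Suc k < n then - 1 else if Suc k = n then s else 1)"

lemma chain_surj: assumes "i < 2 * n" obtains k where "k < 2 * n" "i = chain k"
proof (cases "i < n")
  case True
  then show ?thesis using that[of "i + n"] by (simp add: chain_def)
next
  case False
  then show ?thesis using that[of "2 * n - 1 - i"] assms by (simp add: chain_def)
qed

lemma wshift_chain_0: "wshift s v (chain 0) = 0"
  using n_ge_2 by (simp add: wshift_def chain_def)

lemma wshift_chain_Suc: "Suc k < 2 * n \<Longrightarrow> wshift s v (chain (Suc k)) = weight s k * v (chain k)"
proof -
  assume k: "Suc k < 2 * n"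
  consider "Suc k < n" | "Suc k = n" | "n \<le> k" by linarith
  then show ?thesis
  proof cases
    case 1
    then have "2 * n - 1 - Suc k + 1 = 2 * n - 1 - k" "\<not> 2 * n - 1 - Suc k < n"
      "2 * n - 1 - Suc k < 2 * n - 1" "2 * n - 1 - Suc k \<noteq> 0" "k < n" by linarith+
    then show ?thesis using 1 by (simp only: wshift_def chain_def weight_def) simp
  next
    case 2
    then have "2 * n - 1 - k = n" "k < n" by linarith+
    then show ?thesis using 2 by (simp add: wshift_def chain_def weight_def)
  next
    case 3
    then have "Suc k - n \<noteq> 0" "Suc k - n < n" "Suc k - n - 1 = k - n" using k by linarith+
    then show ?thesis using 3 by (simp add: wshift_def chain_def weight_def)
  qed
qed

text \<open>Applying the map \<open>i\<close> times shifts the coordinates by \<open>i\<close>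
  places along the chain, multiplies them by the weights passed, and fills the start with
  zeros.\<close>

lemma wshift_pow_chain:
  "k < 2 * n \<Longrightarrow> k < i \<Longrightarrow> (wshift s ^^ i) v (chain k) = 0"
  "i < 2 * n \<Longrightarrow> (wshift s ^^ i) v (chain i) = (\<Prod>k<i. weight s k) * v (chain 0)"
proof -
  show "k < 2 * n \<Longrightarrow> k < i \<Longrightarrow> (wshift s ^^ i) v (chain k) = 0" for k
  proof (induction i arbitrary: k)
    case (Suc i)
    then show ?case by (cases k) (simp_all add: wshift_chain_0 wshift_chain_Suc)
  qed simp
  show "i < 2 * n \<Longrightarrow> (wshift s ^^ i) v (chain i) = (\<Prod>k<i. weight s k) * v (chain 0)"
    by (induction i) (simp_all add: wshift_chain_Suc)
qed

lemma wshift_V: "v \<in> V \<Longrightarrow> wshift s v \<in> V"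
  using n_ge_2 by (simp add: wshift_def coords_def)

lemma wshift_pow_V: "v \<in> V \<Longrightarrow> (wshift s ^^ i) v \<in> V"
  by (induction i) (simp_all add: wshift_V)

text \<open>The right-hand side is symmetric in \<open>v\<close> and \<open>w\<close>, which is how
  skewness of \<open>wshift s\<close> is obtained.\<close>

lemma wshift_form:
  "sform n (wshift s v) w
    = - (\<Sum>i<n - 1. v (n + i + 1) * w i + v i * w (n + i + 1)) - s * v n * w n"
proof -
  obtain m where m: "n = Suc m" "m > 0" using n_ge_2 by (cases n) auto
  have last: "(\<Sum>i<n. f i) = (\<Sum>i<m. f i) + f m"
    and first: "(\<Sum>i<n. f i) = f 0 + (\<Sum>i<m. f (Suc i))" for f :: "nat \<Rightarrow> 'a"
    unfolding m(1) by (rule sum.lessThan_Suc, rule sum.lessThan_Suc_shift)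
  have ws: "wshift s v (n + m) = 0" "wshift s v 0 = s * v n"
    "i < m \<Longrightarrow> wshift s v (n + i) = - v (n + i + 1)" "i < m \<Longrightarrow> wshift s v (Suc i) = v i" for i
    unfolding wshift_def using m by auto
  have 1: "(\<Sum>i<n. wshift s v (n + i) * w i) = - (\<Sum>i<m. v (n + i + 1) * w i)"
    unfolding last ws(1) sum_negf[symmetric] by (simp add: ws(3))
  have 2: "(\<Sum>i<n. wshift s v i * w (n + i)) = s * v n * w n + (\<Sum>i<m. v i * w (n + i + 1))"
    unfolding first ws(2) by (simp add: ws(4) One_nat_def)
  have "n - 1 = m" using m by simp
  then show ?thesis unfolding sform_def sum_subtractf 1 2 by (simp add: sum.distrib)
qed

lemma wshift_skew: "sform n (wshift s v) w = - sform n v (wshift s w)"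
proof -
  have "sform n (wshift s v) w = sform n (wshift s w) v"
    unfolding wshift_form by (simp add: add.commute mult.commute mult.left_commute)
  then show ?thesis using form_anti[of v "wshift s w"] by simp
qed

lemma roots_nonempty:
  assumes p: "prime p" "CHAR('a) = p" "2 * n - 1 = p ^ j"
  shows "roots 1 \<noteq> {}"
proof -
  \<comment> \<open>The only weight that depends on \<open>s\<close> sits at \<open>n - 1\<close>.
    The others have a nonzero product \<open>d\<close>, and \<open>s\<close> is solved from the
    normalisation in \<open>X_root\<close>.\<close>
  define d where "d = (\<Prod>k\<in>{..<2 * n - 1} - {n - 1}. weight 1 k)"
  have d: "d \<noteq> 0" unfolding d_def by (auto simp: weight_def)
  define s where "s = 1 / (2 ^ (2 * n - 1) * d)"
  have "(\<Prod>k<2 * n - 1. weight s k) = weight s (n - 1) * (\<Prod>k\<in>{..<2 * n - 1} - {n - 1}. weight s k)"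
    using n_ge_2 by (intro prod.remove) auto
  also have "weight s (n - 1) = s" using n_ge_2 by (simp add: weight_def)
  also have "(\<Prod>k\<in>{..<2 * n - 1} - {n - 1}. weight s k) = d"
    unfolding d_def by (rule prod.cong) (auto simp: weight_def)
  finally have s: "2 ^ (2 * n - 1) * (\<Prod>k<2 * n - 1. weight s k) = 1"
    using d two_neq_0 by (simp add: s_def)
  show ?thesis
  proof (rule cayley_root[OF p, where X = "wshift s"])
    show "wshift s (v + w) = wshift s v + wshift s w" for v w
      by (rule ext) (simp add: wshift_def distrib_left)
    show "wshift s (cscale c v) = cscale c (wshift s v)" for c v
      by (rule ext) (simp add: wshift_def cscale_apply)
    show "wshift s v \<in> V" if "v \<in> V" for v using that by (rule wshift_V)
    show "sform n (wshift s v) w = - sform n v (wshift s w)" for v w by (rule wshift_skew)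
    show "(wshift s ^^ (2 * n)) v = 0" if "v \<in> V" for v
    proof (rule coords_eqI[OF wshift_pow_V[OF that]])
      fix i assume "i < 2 * n"
      then obtain k where "k < 2 * n" "i = chain k" by (rule chain_surj)
      then show "(wshift s ^^ (2 * n)) v i = 0 i" by (simp add: wshift_pow_chain)
    qed (rule U_closed)
    show "cscale (2 ^ (2 * n - 1)) ((wshift s ^^ (2 * n - 1)) v) = cscale (sform n v e) e"
      if v: "v \<in> V" for v
    proof (rule coords_eqI)
      show "cscale (2 ^ (2 * n - 1)) ((wshift s ^^ (2 * n - 1)) v) \<in> V" "cscale (sform n v e) e \<in> V"
        using v by (auto intro: U_closed wshift_pow_V)
      fix i assume "i < 2 * n"
      then obtain k where k: "k < 2 * n" "i = chain k" by (rule chain_surj)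
      show "cscale (2 ^ (2 * n - 1)) ((wshift s ^^ (2 * n - 1)) v) i = cscale (sform n v e) e i"
      \<comment> \<open>The power \<open>2 * n - 1\<close> only carries the start of the chain,
        coordinate \<open>2 * n - 1\<close>, to its end, coordinate \<open>n - 1\<close>, the
        support of \<open>e\<close>.\<close>
      proof (cases "k = 2 * n - 1")
        case True
        have c: "chain 0 = 2 * n - 1" "chain (2 * n - 1) = n - 1" "2 * n - 1 < 2 * n"
          using n_ge_2 by (auto simp: chain_def)
        show ?thesis
          unfolding k True cscale_apply wshift_pow_chain(2)[OF c(3)] c(1) mult.assoc[symmetric] s sform_e
          by (simp add: c cunit_def)
      next
        case False
        then have "chain k \<noteq> n - 1" using k n_ge_2 by (auto simp: chain_def split: if_splits)
        then show ?thesis using k False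
          by (simp add: cscale_apply wshift_pow_chain cunit_def)
      qed
    qed
  qed
qed

end

subsection \<open>Central quotients of order two\<close>

locale central_involution = group G for G (structure) +
  fixes z
  assumes z_carrier [simp]: "z \<in> carrier G" and z_neq_1: "z \<noteq> \<one>" and z_z: "z \<otimes> z = \<one>"
    and z_central: "x \<in> carrier G \<Longrightarrow> z \<otimes> x = x \<otimes> z"
begin

lemma z_z_mult: "x \<in> carrier G \<Longrightarrow> z \<otimes> (z \<otimes> x) = x"
  by (simp add: z_z flip: m_assoc)

lemma z_mult_neq: "x \<in> carrier G \<Longrightarrow> z \<otimes> x \<noteq> x"
  using r_cancel_one[of x z] z_neq_1 by simp

lemma z_pow_odd: "odd m \<Longrightarrow> z [^] m = z" for m :: nat
proof (induction m rule: less_induct)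
  case (less m)
  show ?case
  proof (cases "m = 1")
    case False
    then obtain i where i: "m = Suc (Suc i)" "odd i" using less.prems
      by (metis One_nat_def even_zero even_Suc not0_implies_Suc)
    then show ?thesis using less.IH[of i] by (simp add: m_assoc z_z)
  qed (simp add: nat_pow_eone)
qed

lemma z_mult_pow_odd:
  assumes "odd (m::nat)" "x \<in> carrier G"
  shows "(z \<otimes> x) [^] m = z \<otimes> x [^] m"
  using pow_mult_distrib[OF z_central[OF assms(2)] z_carrier assms(2), of m] z_pow_odd[OF assms(1)]
  by simp

abbreviation Z where "Z \<equiv> {\<one>, z}"

lemma normal_Z: "Z \<lhd> G"
proof -
  have iz: "inv z = z" by (rule inv_equality) (simp_all add: z_z)
  have "subgroup Z G"
    by (rule subgroupI) (auto simp: z_z iz)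
  moreover have "x \<otimes> h \<otimes> inv x \<in> Z" if "x \<in> carrier G" "h \<in> Z" for x h
    using that by (auto simp: m_assoc simp flip: z_central)
  ultimately show ?thesis unfolding normal_inv_iff by blast
qed

sublocale Z: normal Z G by (rule normal_Z)

lemma coset_eq: "x \<in> carrier G \<Longrightarrow> Z #> x = {x, z \<otimes> x}"
  unfolding r_coset_def by auto

lemma coset_eq_iff:
  "x \<in> carrier G \<Longrightarrow> y \<in> carrier G \<Longrightarrow> Z #> x = Z #> y \<longleftrightarrow> x = y \<or> x = z \<otimes> y"
  by (auto simp: coset_eq doubleton_eq_iff z_z_mult)

lemma group_Mod: "group (G Mod Z)"
  by (rule Z.factorgroup_is_group)

lemma carrier_Mod: "carrier (G Mod Z) = (\<lambda>x. Z #> x) ` carrier G"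
  by (auto simp: FactGroup_def RCOSETS_def)

lemma coset_mult: "x \<in> carrier G \<Longrightarrow> y \<in> carrier G \<Longrightarrow> (Z #> x) \<otimes>\<^bsub>G Mod Z\<^esub> (Z #> y) = Z #> (x \<otimes> y)"
  by (simp add: FactGroup_def Z.rcos_sum)

lemma coset_pow:
  assumes x: "x \<in> carrier G"
  shows "(Z #> x) [^]\<^bsub>G Mod Z\<^esub> (m::nat) = Z #> (x [^] m)"
proof -
  interpret Mod: group "G Mod Z" by (rule group_Mod)
  show ?thesis
  proof (induction m)
    case 0
    have "Z #> \<one> = Z" by (rule coset_mult_one[OF Z.subset])
    then show ?case by (simp add: FactGroup_def)
  next
    case (Suc m)
    then show ?case using coset_mult[OF nat_pow_closed[OF x] x] by simp
  qed
qed

lemma card_Mod_dvd: "card (carrier (G Mod Z)) dvd card (carrier G)"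
  using lagrange[OF Z.subgroup_axioms] unfolding FactGroup_def order_def
  by (metis dvd_triv_left partial_object.select_convs(1))

lemma coset_FSZ_iff:
  assumes a: "a \<in> carrier G" and u: "u \<in> carrier G" and h: "h \<in> carrier G"
  shows "Z #> a \<in> FSZ_set (G Mod Z) m (Z #> u) (Z #> h) \<longleftrightarrow>
    (a [^] m = h \<or> a [^] m = z \<otimes> h) \<and> ((a \<otimes> u) [^] m = h \<or> (a \<otimes> u) [^] m = z \<otimes> h)"
proof -
  have "Z #> a \<in> carrier (G Mod Z)" using a unfolding carrier_Mod by blast
  then show ?thesis
    unfolding FSZ_set_def mem_Collect_eq coset_mult[OF a u] coset_pow[OF a]
      coset_pow[OF m_closed[OF a u]] coset_eq_iff[OF nat_pow_closed[OF a] h]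
      coset_eq_iff[OF nat_pow_closed[OF m_closed[OF a u]] h] by simp
qed

text \<open>Since \<open>m\<close> is odd, multiplying \<open>a\<close> by \<open>z\<close>
  multiplies its \<open>m\<close>-th power by \<open>z\<close>, so each coset on the left has
  exactly one representative with \<open>a [^] m = h\<close>. The power of
  \<open>a \<otimes> u\<close> is then \<open>h\<close> or \<open>z \<otimes> h\<close>, which gives
  the two disjoint sets on the right.\<close>

lemma card_FSZ_Mod:
  assumes m: "odd (m::nat)" and u: "u \<in> carrier G" and h: "h \<in> carrier G"
    and fin: "finite (carrier G)"
  shows "card (FSZ_set (G Mod Z) m (Z #> u) (Z #> h))
    = card (FSZ_set G m u h) + card (FSZ_set G m (z \<otimes> u) h)"
proof -
  let ?P = "FSZ_set G m u h" and ?Q = "FSZ_set G m (z \<otimes> u) h"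
  have P: "a \<in> ?P \<longleftrightarrow> a \<in> carrier G \<and> a [^] m = h \<and> (a \<otimes> u) [^] m = h" for a
    by (simp add: FSZ_set_def)
  have azu: "a \<otimes> (z \<otimes> u) = z \<otimes> (a \<otimes> u)" if "a \<in> carrier G" for a
    using that u by (simp add: z_central[of a] flip: m_assoc)
  have Q: "a \<in> ?Q \<longleftrightarrow> a \<in> carrier G \<and> a [^] m = h \<and> (a \<otimes> u) [^] m = z \<otimes> h" for a
  proof -
    have "z \<otimes> x = h \<longleftrightarrow> x = z \<otimes> h" if "x \<in> carrier G" for x
      using that h z_z_mult by metis
    then show ?thesis using u m by (auto simp: FSZ_set_def azu z_mult_pow_odd)
  qed
  have "finite ?P" "finite ?Q" using fin by (simp_all add: FSZ_set_def)
  moreover have "?P \<inter> ?Q = {}" using P Q z_mult_neq[OF h] by auto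
  ultimately have "card ?P + card ?Q = card (?P \<union> ?Q)" by (rule card_Un_disjoint[symmetric])
  also have "\<dots> = card ((\<lambda>x. Z #> x) ` (?P \<union> ?Q))"
  proof (rule card_image[symmetric], rule inj_onI)
    fix a b assume ab: "a \<in> ?P \<union> ?Q" "b \<in> ?P \<union> ?Q" "Z #> a = Z #> b"
    then have c: "a \<in> carrier G" "b \<in> carrier G" "a [^] m = h" "b [^] m = h" using P Q by auto
    then have "a = b \<or> a = z \<otimes> b" using coset_eq_iff ab(3) by simp
    then show "a = b"
    proof
      assume "a = z \<otimes> b"
      then have "a [^] m = z \<otimes> b [^] m" using z_mult_pow_odd[OF m c(2)] by simp
      then have "z \<otimes> h = h" unfolding c(3,4) by (rule sym)
      then show "a = b" using z_mult_neq[OF h] by contradiction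
    qed
  qed
  also have "(\<lambda>x. Z #> x) ` (?P \<union> ?Q) = FSZ_set (G Mod Z) m (Z #> u) (Z #> h)"
  proof (intro equalityI subsetI)
    fix C assume "C \<in> (\<lambda>x. Z #> x) ` (?P \<union> ?Q)"
    then obtain a where a: "C = Z #> a" "a \<in> carrier G" "a [^] m = h"
      "(a \<otimes> u) [^] m = h \<or> (a \<otimes> u) [^] m = z \<otimes> h" using P Q by blast
    then show "C \<in> FSZ_set (G Mod Z) m (Z #> u) (Z #> h)"
      unfolding a(1) coset_FSZ_iff[OF a(2) u h] by simp
  next
    fix C assume C: "C \<in> FSZ_set (G Mod Z) m (Z #> u) (Z #> h)"
    then obtain b where b: "C = Z #> b" "b \<in> carrier G" unfolding FSZ_set_def carrier_Mod by blast
    have "\<exists>a\<in>carrier G. C = Z #> a \<and> a [^] m = h"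
    proof (cases "b [^] m = h")
      case False
      then have bm: "b [^] m = z \<otimes> h"
        using C unfolding b(1) coset_FSZ_iff[OF b(2) u h] by simp
      then have 1: "(z \<otimes> b) [^] m = h" using z_mult_pow_odd[OF m b(2)] z_z_mult[OF h] by simp
      have 2: "C = Z #> (z \<otimes> b)" using b by (simp add: coset_eq_iff z_z_mult)
      show ?thesis by (rule bexI[of _ "z \<otimes> b"]) (simp_all only: 1 2 m_closed z_carrier b(2))
    next
      case True
      then show ?thesis using b by (intro bexI[of _ b] conjI)
    qed
    then obtain a where a: "a \<in> carrier G" "C = Z #> a" "a [^] m = h" by blast
    have "(a \<otimes> u) [^] m = h \<or> (a \<otimes> u) [^] m = z \<otimes> h"
      using C unfolding a(2) coset_FSZ_iff[OF a(1) u h] by simp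
    then have "a \<in> ?P \<union> ?Q" using a(1,3) unfolding Un_iff P Q by simp
    then show "C \<in> (\<lambda>x. Z #> x) ` (?P \<union> ?Q)" unfolding a(2) by (rule imageI)
  qed
  finally show ?thesis by simp
qed

end

section \<open>The centre and the projective group\<close>

context symp_coords
begin

sublocale neg: central_involution G neg
proof unfold_locales
  show "neg \<in> carrier G" by (rule neg_Sp)
  show "neg \<noteq> \<one>\<^bsub>G\<^esub>"
  proof
    assume "neg = \<one>\<^bsub>G\<^esub>"
    then have "act neg e = act (1\<^sub>m (2 * n)) e" by simp
    then have "- e = e" by (simp only: act_neg[OF e_V] act_one[OF e_V])
    then have "- e (n - 1) = e (n - 1)" by (metis uminus_apply)
    then show False using two_neq_0 by (simp add: cunit_def eq_neg_iff_add_eq_0 neg_eq_iff_add_eq_0)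
  qed
  show "neg \<otimes>\<^bsub>G\<^esub> neg = \<one>\<^bsub>G\<^esub>"
    using neg_mult(1)[OF neg_Sp] by (simp add: neg_def)
  show "neg \<otimes>\<^bsub>G\<^esub> x = x \<otimes>\<^bsub>G\<^esub> neg" if "x \<in> carrier G" for x
    using neg_mult[OF that] by simp
qed

text \<open>An element that commutes with the transvection along \<open>x\<close> has
  \<open>x\<close> as an eigenvector. Sums of unit vectors force their eigenvalues to be
  equal.\<close>

lemma center_scalar:
  assumes z: "z \<in> center G"
  obtains c where "\<And>j. j < 2 * n \<Longrightarrow> act z (cunit j) = cscale c (cunit j)"
proof -
  have zG: "z \<in> carrier G" and comm: "\<And>x. x \<in> carrier G \<Longrightarrow> z * x = x * z"
    using z by (auto simp: center_def)
  have eigen: "\<exists>c. act z x = cscale c x" if x: "x \<in> V" for x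
  proof (cases "x = 0")
    case True
    then have "act z x = cscale 0 x" using act_cscale[of z 0 x] by simp
    then show ?thesis by blast
  next
    case False
    \<comment> \<open>The transvection along \<open>x\<close> sends this \<open>y\<close> to
      \<open>y - x\<close>, so commuting expresses \<open>act z x\<close> as a multiple of
      \<open>x\<close>.\<close>
    obtain y where y: "y \<in> V" "sform n x y = 1" using dual[OF x False] .
    have yx: "sform n y x = - 1" using form_anti[of y x] y by simp
    have "act z (act (tmat x 1) y) = act (tmat x 1) (act z y)"
      using comm[OF tmat_Sp[OF x]] zG by (simp add: tmat_Sp[OF x] flip: Sp_act_mult)
    then have "act z (transv x 1 y) = transv x 1 (act z y)"
      using x y Sp_act_V[OF zG] by (simp add: act_tmat)
    then have "cscale (- 1) (act z x) = cscale (sform n (act z y) x) x"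
      unfolding transv_def yx act_add act_cscale by simp
    then have "cscale (- 1) (cscale (- 1) (act z x)) = cscale (- 1) (cscale (sform n (act z y) x) x)"
      by simp
    then have "act z x = cscale (- sform n (act z y) x) x"
      unfolding scale_scale by simp
    then show ?thesis by blast
  qed
  obtain c where c: "act z (cunit 0) = cscale c (cunit 0)"
    using eigen[OF cunit_in_coords, of 0] n_ge_2 by auto
  have "act z (cunit j) = cscale c (cunit j)" if j: "j < 2 * n" for j
  proof (cases "j = 0")
    case False
    have V: "cunit 0 \<in> V" "cunit j \<in> V" using j n_ge_2 by (auto intro: cunit_in_coords)
    obtain d where d: "act z (cunit j) = cscale d (cunit j)" using eigen[OF V(2)] by blast
    obtain b where b: "act z (cunit 0 + cunit j) = cscale b (cunit 0 + cunit j)"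
      using eigen[OF U_closed(1)[OF V]] by blast
    have eq: "cscale b (cunit 0 + cunit j) = cscale c (cunit 0) + cscale d (cunit j :: nat \<Rightarrow> 'a)"
      using b unfolding act_add c d by simp
    have "b = c" "b = d"
      using fun_cong[OF eq, of 0] fun_cong[OF eq, of j] False by (auto simp: cscale_apply cunit_def)
    then show ?thesis using d by simp
  qed (use c in simp)
  then show ?thesis by (rule that)
qed

lemma center_Sp: "center G = {\<one>\<^bsub>G\<^esub>, neg}"
proof (intro equalityI subsetI)
  fix z assume z: "z \<in> center G"
  then have zG: "z \<in> carrier G" by (simp add: center_def)
  obtain c where c: "\<And>j. j < 2 * n \<Longrightarrow> act z (cunit j) = cscale c (cunit j)"
    using center_scalar[OF z] by blast
  have zc: "z = c \<cdot>\<^sub>m 1\<^sub>m (2 * n)"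
  proof (rule eq_matI)
    fix i j assume "i < dim_row (c \<cdot>\<^sub>m 1\<^sub>m (2 * n))" "j < dim_col (c \<cdot>\<^sub>m 1\<^sub>m (2 * n))"
    then have ij: "i < 2 * n" "j < 2 * n" by simp_all
    have "z $$ (i, j) = c * cunit j i"
      using act_cunit[OF Sp_carrier_mat[OF zG] ij] c[OF ij(2)] by (simp add: cscale_apply)
    then show "z $$ (i, j) = (c \<cdot>\<^sub>m 1\<^sub>m (2 * n)) $$ (i, j)" using ij by (simp add: cunit_def)
  qed (use Sp_carrier_mat[OF zG] in auto)
  have V: "cunit 0 \<in> V" "cunit n \<in> V" and n: "0 < n" "0 < 2 * n" "n < 2 * n"
    using n_ge_2 by (auto intro: cunit_in_coords)
  have "sform n (act z (cunit 0)) (act z (cunit n)) = sform n (cunit 0) (cunit n)"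
    by (rule Sp_form[OF zG V])
  moreover have "sform n (cunit 0) (cunit n :: nat \<Rightarrow> 'a) = - 1"
    using sform_cunit(2)[OF n(1), of "cunit 0 :: nat \<Rightarrow> 'a"] by (simp add: cunit_def)
  ultimately have "c * c = 1" using c[OF n(2)] c[OF n(3)] by simp
  then have "c = 1 \<or> c = - 1" by (simp add: square_eq_1_iff)
  then show "z \<in> {\<one>\<^bsub>G\<^esub>, neg}"
  proof
    assume "c = - 1"
    then have "z = neg" unfolding zc neg_def by (intro eq_matI) auto
    then show ?thesis by simp
  qed (use zc in auto)
next
  fix z assume "z \<in> {\<one>\<^bsub>G\<^esub>, neg}"
  then show "z \<in> center G"
    unfolding center_def using neg.z_central neg_Sp Sp.one_closed Sp.l_one Sp.r_one
    by (auto simp del: Sp_simps)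
qed

text \<open>\<open>ex_asymmetric\<close> gives a \<open>u\<close> with different symmetrised counts.
  For \<open>Sp\<close>, one of \<open>u\<close> and \<open>- u\<close> is then a witness; for
  \<open>PSp\<close>, the symmetrised count is the count at the coset of \<open>u\<close>.\<close>

lemma non_FSZ:
  assumes p: "prime p" "CHAR('a) = p" "2 * n - 1 = p ^ j"
    and \<chi>: "quadratic_char (\<chi> :: 'a \<Rightarrow> int)" "\<chi> (of_nat k) = - 1"
    and k: "k > 0" "coprime k (card (carrier G))"
  shows "non_FSZ_at G (2 * n - 1) g \<and> non_FSZ_at (PSp TYPE('a) n) (2 * n - 1) (PSp_proj n g)"
proof -
  let ?m = "2 * n - 1"
  have gG: "g \<in> carrier G" by (rule tmat_Sp[OF e_V])
  have g1: "g [^]\<^bsub>G\<^esub> (1::nat) = g" by (rule Sp.nat_pow_eone[OF gG])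
  have gk: "g [^]\<^bsub>G\<^esub> k \<in> carrier G" using gG by (rule Sp.nat_pow_closed)
  have m: "odd ?m" using n_ge_2 by simp
  obtain u where u: "u \<in> carrier G"
    "card (FSZ_set G ?m u g) + card (FSZ_set G ?m (- u) g)
      \<noteq> card (FSZ_set G ?m u (g [^]\<^bsub>G\<^esub> k)) + card (FSZ_set G ?m (- u) (g [^]\<^bsub>G\<^esub> k))"
    using ex_asymmetric[OF p \<chi> roots_nonempty[OF p]] unfolding g1 by blast
  have nu: "neg \<otimes>\<^bsub>G\<^esub> u = - u" using neg_mult(1)[OF u(1)] by simp
  then have nuG: "- u \<in> carrier G" using Sp.m_closed[OF neg_Sp u(1)] by simp
  have "non_FSZ_at G ?m g"
    unfolding non_FSZ_at_def using gG u nuG k by (metis (no_types, lifting))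
  moreover have PSp: "PSp TYPE('a) n = G Mod neg.Z" and proj: "PSp_proj n M = neg.Z #>\<^bsub>G\<^esub> M" for M
    by (simp_all add: PSp_def PSp_proj_def center_Sp)
  have "non_FSZ_at (PSp TYPE('a) n) ?m (PSp_proj n g)"
    unfolding non_FSZ_at_def PSp proj
  proof (intro conjI bexI exI)
    show "neg.Z #>\<^bsub>G\<^esub> g \<in> carrier (G Mod neg.Z)" "neg.Z #>\<^bsub>G\<^esub> u \<in> carrier (G Mod neg.Z)"
      unfolding neg.carrier_Mod using gG u(1) by blast+
    show "coprime k (card (carrier (G Mod neg.Z)))"
      by (rule coprime_divisors[OF dvd_refl neg.card_Mod_dvd k(2)])
    show "card (FSZ_set (G Mod neg.Z) ?m (neg.Z #>\<^bsub>G\<^esub> u) (neg.Z #>\<^bsub>G\<^esub> g))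
      \<noteq> card (FSZ_set (G Mod neg.Z) ?m (neg.Z #>\<^bsub>G\<^esub> u) ((neg.Z #>\<^bsub>G\<^esub> g) [^]\<^bsub>G Mod neg.Z\<^esub> k))"
      using u unfolding neg.coset_pow[OF gG] neg.card_FSZ_Mod[OF m u(1) gG finite_Sp]
        neg.card_FSZ_Mod[OF m u(1) gk finite_Sp] nu by simp
  qed (rule k)
  ultimately show ?thesis by blast
qed

end

subsection \<open>The quadratic character\<close>

definition qchar :: "'a::{field,finite} \<Rightarrow> int" where
  "qchar x = (if x = 0 then 0 else if x ^ ((CARD('a) - 1) div 2) = 1 then 1 else - 1)"

text \<open>The library version is for the class \<open>finite_field\<close>, which is not known to contain the sort
  \<open>{field, finite}\<close>.\<close>

lemma finite_field_power_card_minus_1: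
  fixes x :: "'a::{field,finite}"
  assumes "x \<noteq> 0"
  shows "x ^ (CARD('a) - 1) = 1"
proof -
  \<comment> \<open>Multiplication by \<open>x\<close> permutes the nonzero elements and so
    preserves their product.\<close>
  have "x * (\<Prod>y\<in>UNIV - {0}. x * y) = x * x ^ (CARD('a) - 1) * \<Prod>(UNIV - {0})"
    by (simp add: prod.distrib mult_ac)
  moreover have "(\<Prod>y\<in>UNIV - {0}. x * y) = (\<Prod>y\<in>UNIV - {0}. y)"
    by (rule prod.reindex_bij_witness[of _ "\<lambda>y. y / x" "\<lambda>y. x * y"]) (use assms in auto)
  ultimately show ?thesis using assms by simp
qed

lemma power_half_card:
  fixes x :: "'a::{field,finite}"
  assumes "odd (CARD('a))" "x \<noteq> 0"
  shows "x ^ ((CARD('a) - 1) div 2) = 1 \<or> x ^ ((CARD('a) - 1) div 2) = - 1"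
proof -
  have "x ^ ((CARD('a) - 1) div 2) * x ^ ((CARD('a) - 1) div 2) = x ^ (CARD('a) - 1)"
    using assms(1) by (simp flip: power_add mult_2)
  then show ?thesis
    using finite_field_power_card_minus_1[OF assms(2)] by (simp add: square_eq_1_iff)
qed

text \<open>The values \<open>1\<close> and \<open>- 1\<close> of the Euler power multiply as signs
  do, and the exponent is even because the order is 1 modulo 4, which gives \<open>- 1\<close> the
  value 1.\<close>

lemma quadratic_char_qchar:
  assumes q: "CARD('a::{field,finite}) mod 4 = 1" and two: "(2::'a) \<noteq> 0"
    and d: "(d::'a) ^ ((CARD('a) - 1) div 2) = - 1"
  shows "quadratic_char (qchar :: 'a \<Rightarrow> int)" "qchar d = - 1"
proof -
  let ?h = "(CARD('a) - 1) div 2"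
  have odd: "odd (CARD('a))" using q by presburger
  have h: "even ?h" using q by presburger
  have h0: "?h \<noteq> 0"
  proof
    assume "?h = 0"
    then have "(- 1 :: 'a) = 1" using d by simp
    then show False using two by (simp add: eq_neg_iff_add_eq_0 neg_eq_iff_add_eq_0)
  qed
  have neq: "(- 1 :: 'a) \<noteq> 1" using two by (simp add: neg_eq_iff_add_eq_0)
  have d0: "d \<noteq> 0" using d h0 by (auto simp: power_0_left)
  show qd: "qchar d = - 1" using d0 d neq by (simp add: qchar_def)
  show "quadratic_char (qchar :: 'a \<Rightarrow> int)"
  proof
    show "qchar (x * y) = qchar x * qchar y" for x y :: 'a
    proof (cases "x = 0 \<or> y = 0")
      case False
      then have "x ^ ?h = 1 \<or> x ^ ?h = - 1" "y ^ ?h = 1 \<or> y ^ ?h = - 1"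
        using power_half_card[OF odd] by blast+
      then show ?thesis using False neq by (auto simp: qchar_def power_mult_distrib)
    qed (auto simp: qchar_def)
    show "qchar (- 1 :: 'a) = 1" using h by (simp add: qchar_def)
    show "\<exists>d :: 'a. qchar d = - 1" using qd by blast
  qed (auto simp: qchar_def)
qed

text \<open>\<open>S\<close> is the geometric sum of the powers of \<open>p\<close> with exponent
  below \<open>k\<close>, a sum of \<open>k\<close> odd terms.\<close>

lemma prime_power_eq_odd_multiple:
  assumes "odd (p::nat)"
  shows "\<exists>S. p ^ k = 1 + 2 * ((p - 1) div 2 * S) \<and> (odd S \<longleftrightarrow> odd k)"
proof (induction k)
  case 0
  show ?case by (intro exI[of _ 0]) simp
next
  case (Suc k)
  then obtain S where S: "p ^ k = 1 + 2 * ((p - 1) div 2 * S)" "odd S \<longleftrightarrow> odd k" by blast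
  obtain h where h: "p = 2 * h + 1" using assms by (rule oddE)
  have "p ^ Suc k = 1 + 2 * ((p - 1) div 2 * (S + 1 + 2 * (h * S)))"
    unfolding power_Suc S(1) by (simp add: h algebra_simps)
  then show ?case using S(2) by (intro exI[of _ "S + 1 + 2 * (h * S)"]) auto
qed

text \<open>A primitive root \<open>r\<close> modulo \<open>p\<close> has
  \<open>r ^ ((p - 1) div 2) = - 1\<close> in the field. As \<open>k\<close> is odd, the Euler
  exponent of the field is an odd multiple of \<open>(p - 1) div 2\<close>, so the value stays
  \<open>- 1\<close>.\<close>

lemma ex_prime_field_nonsquare:
  assumes p: "prime p" "odd p" and char: "CHAR('a::{field,finite}) = p"
    and card: "CARD('a) = p ^ k" "odd k"
  obtains r where "\<not> p dvd r" "(of_nat r :: 'a) ^ ((CARD('a) - 1) div 2) = - 1"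
proof -
  have p1: "p > 1" using p by (simp add: prime_gt_1_nat)
  obtain r where r: "residue_primroot p r" using prime_primitive_root_exists[OF p1 p(1)] by blast
  then have ord: "ord p r = p - 1" and cop: "coprime p r"
    using p(1) by (auto simp: residue_primroot_def totient_prime)
  let ?h = "(p - 1) div 2"
  have hh: "?h + ?h = p - 1" using p(2) by presburger
  have h0: "0 < ?h" using hh p1 by linarith
  have "\<not> p - 1 dvd ?h" using h0 hh by (auto dest!: dvd_imp_le)
  then have "\<not> [r ^ ?h = 1] (mod p)" by (simp add: ord_divides ord)
  then have y1: "(of_nat r :: 'a) ^ ?h \<noteq> 1"
    using of_nat_eq_iff_cong_CHAR[of "r ^ ?h" 1, where 'a = 'a] by (simp add: char)
  have "[r ^ (?h + ?h) = 1] (mod p)" by (simp add: ord_divides ord hh)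
  then have "(of_nat r :: 'a) ^ ?h * of_nat r ^ ?h = 1"
    using of_nat_eq_iff_cong_CHAR[of "r ^ (?h + ?h)" 1, where 'a = 'a]
    by (simp add: char power_add)
  then have y: "(of_nat r :: 'a) ^ ?h = - 1" using y1 by (simp add: square_eq_1_iff)
  obtain S where S: "p ^ k = 1 + 2 * (?h * S)" "odd S"
    using prime_power_eq_odd_multiple[OF p(2), of k] card(2) by blast
  then have "(CARD('a) - 1) div 2 = ?h * S" by (simp add: card)
  then have "(of_nat r :: 'a) ^ ((CARD('a) - 1) div 2) = - 1"
    using S(2) by (simp add: power_mult y)
  moreover have "\<not> p dvd r" using cop p1 by (metis coprime_absorb_left nat_dvd_1_iff_1 less_irrefl)
  ultimately show ?thesis using that by blast
qed

text \<open>The Chinese remainder theorem for \<open>p\<close> and the prime-to-\<open>p\<close>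
  part \<open>t\<close> of \<open>N\<close>: the residue 1 makes \<open>x\<close> coprime to
  \<open>t\<close>, and the residue \<open>r\<close> makes it coprime to \<open>p\<close>.\<close>

lemma ex_coprime_residue:
  assumes p: "prime (p::nat)" and r: "\<not> p dvd r" and N: "N > 0"
  obtains x where "[x = r] (mod p)" "coprime x N" "x > 0"
proof -
  obtain t where t: "N = p ^ multiplicity p N * t" "\<not> p dvd t"
    using multiplicity_decompose'[of N p] N p by (auto simp: prime_nat_iff)
  have "coprime p t" using p t(2) by (rule prime_imp_coprime)
  then obtain x where x: "[x = r] (mod p)" "[x = 1] (mod t)"
    using binary_chinese_remainder_nat by blast
  have px: "\<not> p dvd x" using r x(1) by (simp add: cong_dvd_iff)
  have "coprime x t" using x(2) by (metis cong_imp_coprime cong_sym coprime_1_left)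
  moreover have "coprime x (p ^ multiplicity p N)"
    using prime_imp_coprime[OF p px] by (simp add: coprime_commute)
  ultimately have "coprime x N" by (subst t(1)) simp
  moreover have "x > 0" using px by (cases x) auto
  ultimately show ?thesis using that x(1) by blast
qed

theorem theorem7p4:
  fixes p q j n k :: nat
  assumes "prime p" and "odd p"
    and "q = p ^ k" and "CARD('a::{field,finite}) = q"
    and "j > 0"
    and "2 * n = p ^ j + 1"
    and "p mod 4 = 1" and "odd k"
  shows "non_FSZ_at (Sp TYPE('a) n) (p ^ j) (g_mat p j n)
       \<and> non_FSZ_at (PSp TYPE('a) n) (p ^ j) (PSp_proj n (g_mat p j n))"
proof -
  note p = \<open>prime p\<close> \<open>odd p\<close>
  have card: "CARD('a) = p ^ k" using assms by simp
  have "prime CHAR('a)"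
    by (rule prime_CHAR_semidom) (rule finite_imp_CHAR_pos, rule finite)
  moreover have "CHAR('a) dvd p ^ k" using CHAR_dvd_CARD[where 'a = 'a] by (simp add: card)
  ultimately have char: "CHAR('a) = p"
    using p(1) by (metis prime_dvd_power primes_dvd_imp_eq)
  have "p \<noteq> 1" using p(1) by auto
  then have p5: "p \<ge> 5" using \<open>p mod 4 = 1\<close> by presburger
  have two: "(2::'a) \<noteq> 0"
    using of_nat_eq_0_iff_char_dvd[of 2, where 'a = 'a] p5 by (auto simp: char dest: dvd_imp_le)
  have "p ^ 1 \<le> p ^ j" using p5 \<open>j > 0\<close> by (intro power_increasing) auto
  then have n2: "n \<ge> 2" using p5 \<open>2 * n = p ^ j + 1\<close> by simp
  have m: "2 * n - 1 = p ^ j" using \<open>2 * n = p ^ j + 1\<close> by simp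
  interpret symp_coords n "TYPE('a)" by unfold_locales (use n2 two in auto)
  have "[p ^ k = 1 ^ k] (mod 4)" using \<open>p mod 4 = 1\<close> by (intro cong_pow) (simp add: cong_def)
  then have q4: "CARD('a) mod 4 = 1" by (simp add: card cong_def)
  obtain r where r: "\<not> p dvd r" "(of_nat r :: 'a) ^ ((CARD('a) - 1) div 2) = - 1"
    using ex_prime_field_nonsquare[OF p char card \<open>odd k\<close>] .
  have "card (carrier G) > 0"
    using finite_Sp Sp.one_closed card_gt_0_iff by blast
  \<comment> \<open>\<open>x\<close> serves as the exponent in \<open>non_FSZ_at\<close>. Being
    congruent to \<open>r\<close> modulo \<open>p\<close>, it has the same nonsquare image in the
    field.\<close>
  then obtain x where x: "[x = r] (mod p)" "coprime x (card (carrier G))" "x > 0"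
    using ex_coprime_residue[OF p(1) r(1)] by blast
  have "(of_nat x :: 'a) = of_nat r" using x(1) of_nat_eq_iff_cong_CHAR[where 'a = 'a] char by blast
  then have chi: "quadratic_char (qchar :: 'a \<Rightarrow> int)" "qchar (of_nat x :: 'a) = - 1"
    using quadratic_char_qchar[OF q4 two r(2)] by simp_all
  \<comment> \<open>The sign in \<open>g_mat\<close> is trivial because 4 divides
    \<open>p - 1\<close>.\<close>
  have "even (j * (p - 1) div 2)"
  proof -
    define t where "t = p div 4"
    have "p = 4 * t + 1" using \<open>p mod 4 = 1\<close> unfolding t_def by presburger
    then have eq: "j * (p - 1) = 2 * (2 * (j * t))" by simp
    show ?thesis unfolding eq by simp
  qed
  then have "(g_mat p j n :: 'a mat) = g" by (rule g_mat_eq)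
  then show ?thesis using non_FSZ[OF p(1) char m chi x(3,2)] by (simp add: m)
qed

end
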